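(* Let $I\subseteq S$ be a proper monomial ideal, let $\mathbf a\succeq\mathbf a_I$, and let $X$ be a labelled regular cell complex such that $\mathbb F_X$ is a cellular resolution of $I+\mathfrak m^{\mathbf a+\mathbf 1}$. If $\mathbb F_X$ has length $n-1$, then $\mathbb F^{(X,X_U)}[-\mathbf a-\mathbf 1](1-n)$ is a relative cocellular resolution of $I^{\mathbf a}$ (i.e. it is a free resolution of $I^{\mathbf a}$). Furthermore, this dual resolution is minimal if $\mathbb F_X$ is.
   Context: $k$ is a field, $n\ge 2$, $S=k[x_1,\ldots,x_n]$, $\mathbb Z^n$-graded; $\preceq$ is the coordinatewise order on $\mathbb Z^n$; $\mathbf 1=(1,\ldots,1)$; $N[\mathbf a]_{\mathbf b}=N_{\mathbf a+\mathbf b}$. Alexander dual: for $\mathbf b\in\mathbb N^n$, $\mathfrak m^{\mathbf b}=\langle x_i^{b_i}\mid b_i\ge 1\rangle$; these are exactly the irreducible monomial ideals. $\mathbf a_I$ is the exponent vector of the lcm of the minimal generators of $I$; $\mathrm{Irr}(I)$ is the set of components of the unique irredundant decomposition of $I$ into irreducible monomial ideals ($\mathfrak m^{\mathbf b}\in\mathrm{Irr}(I)$ implies $\mathbf b\preceq\mathbf a_I$). For $\mathbf 0\preceq\mathbf b\preceq\mathbf a$, $\mathbf b^{\mathbf a}$ has $i$th coordinate $a_i+1-b_i$ if $b_i\ge1$ and $0$ otherwise. For $\mathbf a\succeq\mathbf a_I$, $I^{\mathbf a}=\langle x^{\mathbf b^{\mathbf a}}\mid\mathfrak m^{\mathbf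 b}\in\mathrm{Irr}(I)\rangle$. Cellular complexes: a labelled regular cell complex $X$ is a finite regular cell complex whose vertices $v$ carry labels $\mathbf a_v\in\mathbb Z^n$, each nonempty face $F$ being labelled by the join (componentwise maximum) $\mathbf a_F=\bigvee_{v\in F}\mathbf a_v$, together with an incidence function $\varepsilon(F,G)\in\{1,0,-1\}$ defining the cellular boundary map over $k$. With $m_F=x^{\mathbf a_F}$, the cellular complex is $\mathbb F_X=\bigoplus_{F\ne\emptyset}SF$, with basis element $F$ in $\mathbb Z^n$-degree $\mathbf a_F$ and homological degree $\dim F$, and differential $\partial F=\sum_{G\ne\emptyset}\varepsilon(F,G)\frac{m_F}{m_G}G$. It is a cellular resolution of the module $\langle x^{\mathbf a_v}\mid v\text{ a vertex of }X\rangle$ if it is acyclic (homology only in degree $0$). For a subcomplex $Y\subseteq X$ with induced labels, $\mathbb F^{(X,Y)}=\underline{\mathrm{Hom}}_S(\mathbb F_X/\mathbb F_Y,S)$, where the dual basis element $F^*$ has $\mathbb Z^n$-degree $-\mathbf a_F$ and homological degree $-\dim F$; a free resolution that is, up to shifts, of this form is called relative cocellular. $X_U=\{F\in X\mid\mathbf a_F\not\succeq\mathbf 1\}$ is the negatively unbounded subcomplex. For a complex $\mathbb F$ with $N_i$ in homological degree $i$, $\mathbb F[\mathbf a](j)$ has $N_i[\mathbf a]$ in homological degree $i-j$. A free complex is minimal if its differential has image in $\langle x_1,\ldots,x_n\rangle$ times the complex.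
   Formalization: "Cellular resolution of I+m^{a+1}" means that F_X is a free resolution of this ideal: homology only in degree 0 and, in addition, degree-0 homology isomorphic to the ideal; with acyclicity alone the claim fails (e.g. when X has an extra isolated vertex). *)

theory Defs
  imports "HOL-Analysis.Analysis" "HOL-Library.Poly_Mapping" "HOL-Library.Function_Algebras"
begin

text \<open>
  The polynomial ring S over 'k has its variables indexed by the finite type 'n. Exponent vectors
  are functions to nat, multidegrees are functions to int, both ordered pointwise.
\<close>

type_synonym ('n, 'k) mpoly = "('n \<Rightarrow> nat) \<Rightarrow>\<^sub>0 'k"

abbreviation xpow :: "('n \<Rightarrow> nat) \<Rightarrow> ('n, 'k::field) mpoly" where
  "xpow e \<equiv> Poly_Mapping.single e 1"

definition homogeneous :: "('n \<Rightarrow> int) \<Rightarrow> ('n, 'k::field) mpoly \<Rightarrow> bool" where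
  "homogeneous d p \<longleftrightarrow> (\<forall>e \<in> Poly_Mapping.keys p. (\<lambda>i. int (e i)) = d)"


section \<open>Monomial ideals and the Alexander dual\<close>

abbreviation ideal_span :: "('n, 'k::field) mpoly set \<Rightarrow> ('n, 'k) mpoly set" where
  "ideal_span \<equiv> module.span (*)"

definition monomial_ideal :: "('n, 'k::field) mpoly set \<Rightarrow> bool" where
  "monomial_ideal I \<longleftrightarrow> (\<exists>E. I = ideal_span (xpow ` E))"

definition ideal_sum :: "('n, 'k::field) mpoly set \<Rightarrow> ('n, 'k) mpoly set \<Rightarrow> ('n, 'k) mpoly set" where
  "ideal_sum I J = {p + q | p q. p \<in> I \<and> q \<in> J}"

definition min_gens :: "('n, 'k::field) mpoly set \<Rightarrow> ('n \<Rightarrow> nat) set" where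
  "min_gens I = {e. xpow e \<in> I \<and> (\<forall>e'. xpow e' \<in> I \<longrightarrow> e' \<le> e \<longrightarrow> e' = e)}"

text \<open>The exponent of the lcm of the minimal generators; the inserted 0 only matters for the zero ideal.\<close>

definition lcm_exponent :: "('n, 'k::field) mpoly set \<Rightarrow> 'n \<Rightarrow> nat" where
  "lcm_exponent I i = Max (insert 0 ((\<lambda>e. e i) ` min_gens I))"

definition m_pow :: "('n \<Rightarrow> nat) \<Rightarrow> ('n, 'k::field) mpoly set" where
  "m_pow b = ideal_span {xpow (0(i := b i)) | i. b i \<ge> 1}"

text \<open>
  The ideals \<open>m_pow b\<close> are exactly the irreducible monomial ideals (the zero ideal
  being \<open>m_pow 0\<close>). The empty intersection is the unit ideal.
\<close>

definition irredundant_decomposition ::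
    "('n, 'k::field) mpoly set set \<Rightarrow> ('n, 'k) mpoly set \<Rightarrow> bool" where
  "irredundant_decomposition D I \<longleftrightarrow>
     finite D \<and> D \<subseteq> range m_pow \<and> \<Inter>D = I \<and> (\<forall>Q\<in>D. \<Inter>(D - {Q}) \<noteq> I)"

definition Irr :: "('n, 'k::field) mpoly set \<Rightarrow> ('n, 'k) mpoly set set" where
  "Irr I = (THE D. irredundant_decomposition D I)"

text \<open>Used only for \<open>b \<le> a\<close>, where the subtraction does not truncate.\<close>

definition dual_exponent :: "('n \<Rightarrow> nat) \<Rightarrow> ('n \<Rightarrow> nat) \<Rightarrow> 'n \<Rightarrow> nat" where
  "dual_exponent a b i = (if b i \<ge> 1 then a i + 1 - b i else 0)"

definition alexander_dual :: "('n \<Rightarrow> nat) \<Rightarrow> ('n, 'k::field) mpoly set \<Rightarrow> ('n, 'k) mpoly set" where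
  "alexander_dual a I = ideal_span {xpow (dual_exponent a b) | b. m_pow b \<in> Irr I}"


section \<open>Complexes of finitely generated free multigraded modules\<close>

text \<open>
  A complex is given by a finite homogeneous basis of the direct sum of all its modules, the
  multidegree and the homological degree of each basis element, and the matrix of the
  differential: \<open>dcoeff C b b'\<close> is the coefficient of \<open>b'\<close> in the differential of \<open>b\<close>.
  Elements are coordinate functions vanishing outside the basis.
\<close>

record (overloaded) ('b, 'n, 'k) free_complex =
  basis :: "'b set"
  mdeg :: "'b \<Rightarrow> 'n \<Rightarrow> int"
  hdeg :: "'b \<Rightarrow> int"
  dcoeff :: "'b \<Rightarrow> 'b \<Rightarrow> ('n, 'k) mpoly"

definition elements :: "('b, 'n, 'k::field) free_complex \<Rightarrow> ('b \<Rightarrow> ('n, 'k) mpoly) set" where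
  "elements C = {c. \<forall>b. c b \<noteq> 0 \<longrightarrow> b \<in> basis C}"

definition chains :: "('b, 'n, 'k::field) free_complex \<Rightarrow> int \<Rightarrow> ('b \<Rightarrow> ('n, 'k) mpoly) set" where
  "chains C j = {c \<in> elements C. \<forall>b. c b \<noteq> 0 \<longrightarrow> hdeg C b = j}"

definition graded_chains ::
    "('b, 'n, 'k::field) free_complex \<Rightarrow> int \<Rightarrow> ('n \<Rightarrow> int) \<Rightarrow> ('b \<Rightarrow> ('n, 'k) mpoly) set" where
  "graded_chains C j d = {c \<in> chains C j. \<forall>b \<in> basis C. homogeneous (d - mdeg C b) (c b)}"

definition bd ::
    "('b, 'n, 'k::field) free_complex \<Rightarrow> ('b \<Rightarrow> ('n, 'k) mpoly) \<Rightarrow> 'b \<Rightarrow> ('n, 'k) mpoly" where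
  "bd C c = (\<lambda>b'. if b' \<in> basis C then \<Sum>b\<in>basis C. c b * dcoeff C b b' else 0)"

definition is_complex :: "('b, 'n, 'k::field) free_complex \<Rightarrow> bool" where
  "is_complex C \<longleftrightarrow>
     finite (basis C) \<and>
     (\<forall>j. bd C ` chains C j \<subseteq> chains C (j - 1)) \<and>
     (\<forall>j d. bd C ` graded_chains C j d \<subseteq> graded_chains C (j - 1) d) \<and>
     (\<forall>c \<in> elements C. bd C (bd C c) = 0)"

text \<open>
  \<open>C\<close> lives in nonnegative homological degrees, is exact in positive ones, and its zeroth
  homology is isomorphic to \<open>J\<close> as a multigraded S-module, the isomorphism being
  induced by \<open>\<pi>\<close>.
\<close>

definition free_resolution ::
    "('b, 'n, 'k::field) free_complex \<Rightarrow> ('n, 'k) mpoly set \<Rightarrow> bool" where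
  "free_resolution C J \<longleftrightarrow>
     is_complex C \<and>
     (\<forall>b \<in> basis C. hdeg C b \<ge> 0) \<and>
     (\<forall>j > 0. {c \<in> chains C j. bd C c = 0} = bd C ` chains C (j + 1)) \<and>
     (\<exists>\<pi> :: ('b \<Rightarrow> ('n, 'k) mpoly) \<Rightarrow> ('n, 'k) mpoly.
        (\<forall>c \<in> chains C 0. \<forall>c' \<in> chains C 0. \<pi> (c + c') = \<pi> c + \<pi> c') \<and>
        (\<forall>s. \<forall>c \<in> chains C 0. \<pi> (\<lambda>b. s * c b) = s * \<pi> c) \<and>
        (\<forall>d. \<forall>c \<in> graded_chains C 0 d. homogeneous d (\<pi> c)) \<and>
        \<pi> ` chains C 0 = J \<and>
        {c \<in> chains C 0. \<pi> c = 0} = bd C ` chains C 1)"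

definition minimal_complex :: "('b, 'n, 'k::field) free_complex \<Rightarrow> bool" where
  "minimal_complex C \<longleftrightarrow>
     (\<forall>c \<in> elements C. \<forall>b. bd C c b \<in> m_pow 1)"

definition complex_length :: "('b, 'n, 'k::field) free_complex \<Rightarrow> int" where
  "complex_length C = Max (hdeg C ` basis C)"

text \<open>The quotient by the subcomplex spanned by the basis elements in \<open>B\<close>.\<close>

definition quotient_complex ::
    "('b, 'n, 'k::field) free_complex \<Rightarrow> 'b set \<Rightarrow> ('b, 'n, 'k) free_complex" where
  "quotient_complex C B = C\<lparr>basis := basis C - B\<rparr>"

text \<open>The dual \<open>Hom(C, S)\<close> in the dual basis, each dual basis element being denoted by
  the basis element it is dual to; its differential is the transpose.\<close>

definition dual_complex :: "('b, 'n, 'k::field) free_complex \<Rightarrow> ('b, 'n, 'k) free_complex" where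
  "dual_complex C =
     \<lparr>basis = basis C, mdeg = (\<lambda>b. - mdeg C b), hdeg = (\<lambda>b. - hdeg C b),
      dcoeff = (\<lambda>b b'. dcoeff C b' b)\<rparr>"

text \<open>\<open>C[d](j)\<close>: as \<open>N[d]\<close> in degree \<open>e\<close> is \<open>N\<close> in degree \<open>d + e\<close>, the degree of a generator drops by \<open>d\<close>.\<close>

definition shift_complex ::
    "('n \<Rightarrow> int) \<Rightarrow> int \<Rightarrow> ('b, 'n, 'k::field) free_complex \<Rightarrow> ('b, 'n, 'k) free_complex" where
  "shift_complex d j C =
     C\<lparr>mdeg := (\<lambda>b. mdeg C b - d), hdeg := (\<lambda>b. hdeg C b - j)\<rparr>"


section \<open>Labelled regular cell complexes\<close>

text \<open>
  \<open>cells\<close> are the nonempty open cells; a face is identified with its open cell. Vertices are the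
  points \<open>v\<close> with \<open>{v}\<close> a cell, and \<open>vlabel\<close> and \<open>cdim\<close> are relevant only on vertices and
  cells respectively.
\<close>

record ('p, 'n, 'k) cell_complex =
  cspace :: "'p topology"
  cells :: "'p set set"
  cdim :: "'p set \<Rightarrow> nat"
  incidence :: "'p set \<Rightarrow> 'p set \<Rightarrow> 'k"
  vlabel :: "'p \<Rightarrow> 'n \<Rightarrow> int"

definition closed_disc :: "nat \<Rightarrow> (nat \<Rightarrow> real) set" where
  "closed_disc d = {x \<in> topspace (Euclidean_space d). (\<Sum>i<d. (x i)\<^sup>2) \<le> 1}"

definition open_disc :: "nat \<Rightarrow> (nat \<Rightarrow> real) set" where
  "open_disc d = {x \<in> topspace (Euclidean_space d). (\<Sum>i<d. (x i)\<^sup>2) < 1}"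

definition regular_cell_complex :: "('p, 'n, 'k) cell_complex \<Rightarrow> bool" where
  "regular_cell_complex X \<longleftrightarrow>
     Hausdorff_space (cspace X) \<and>
     finite (cells X) \<and> {} \<notin> cells X \<and> disjoint (cells X) \<and>
     topspace (cspace X) = \<Union>(cells X) \<and>
     (\<forall>F \<in> cells X.
        (\<exists>\<phi>. homeomorphic_map
               (subtopology (Euclidean_space (cdim X F)) (closed_disc (cdim X F)))
               (subtopology (cspace X) (cspace X closure_of F)) \<phi> \<and>
             \<phi> ` open_disc (cdim X F) = F) \<and>
        cspace X closure_of F - F =
          \<Union>{G \<in> cells X. G \<subseteq> cspace X closure_of F \<and> cdim X G < cdim X F})"

text \<open>The empty face has dimension -1.\<close>

definition face_dim :: "('p, 'n, 'k) cell_complex \<Rightarrow> 'p set \<Rightarrow> int" where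
  "face_dim X F = (if F = {} then -1 else int (cdim X F))"

definition is_facet :: "('p, 'n, 'k) cell_complex \<Rightarrow> 'p set \<Rightarrow> 'p set \<Rightarrow> bool" where
  "is_facet X G F \<longleftrightarrow> G \<subseteq> cspace X closure_of F \<and> face_dim X G = face_dim X F - 1"

text \<open>
  The usual axioms of an incidence function on a regular cell complex, with values read in the
  field. In the last one there are exactly two faces \<open>H\<close> with a nonzero summand when \<open>G\<close> is a
  face of \<open>F\<close>, and none otherwise; the axiom says that the differential squares to zero, and for
  \<open>G = {}\<close> that the two ends of an edge have opposite signs.
\<close>

definition incidence_function :: "('p, 'n, 'k::field) cell_complex \<Rightarrow> bool" where
  "incidence_function X \<longleftrightarrow>
     (\<forall>F \<in> cells X. \<forall>G \<in> insert {} (cells X).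
        incidence X F G \<in> {1, 0, -1} \<and> (incidence X F G \<noteq> 0 \<longleftrightarrow> is_facet X G F)) \<and>
     (\<forall>v. {v} \<in> cells X \<longrightarrow> incidence X {v} {} = 1) \<and>
     (\<forall>F \<in> cells X. \<forall>G \<in> insert {} (cells X). face_dim X F = face_dim X G + 2 \<longrightarrow>
        (\<Sum>H\<in>cells X. incidence X F H * incidence X H G) = 0)"

definition labelled_regular_cell_complex :: "('p, 'n, 'k::field) cell_complex \<Rightarrow> bool" where
  "labelled_regular_cell_complex X \<longleftrightarrow> regular_cell_complex X \<and> incidence_function X"

definition face_label :: "('p, 'n, 'k) cell_complex \<Rightarrow> 'p set \<Rightarrow> 'n \<Rightarrow> int" where
  "face_label X F i = Max {vlabel X v i | v. {v} \<in> cells X \<and> v \<in> cspace X closure_of F}"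

text \<open>
  The monomial \<open>m_F / m_G\<close> lies in S when \<open>G\<close> is a face of \<open>F\<close>; otherwise it has coefficient 0.
\<close>

definition cellular_complex :: "('p, 'n, 'k::field) cell_complex \<Rightarrow> ('p set, 'n, 'k) free_complex" where
  "cellular_complex X =
     \<lparr>basis = cells X, mdeg = face_label X, hdeg = face_dim X,
      dcoeff = (\<lambda>F G. Poly_Mapping.single (\<lambda>i. nat (face_label X F i - face_label X G i))
                        (incidence X F G))\<rparr>"

text \<open>
  The module generated by the monomials with exponents the vertex labels is an ideal of S only
  if these labels are nonnegative.
\<close>

definition cellular_resolution :: "('p, 'n, 'k::field) cell_complex \<Rightarrow> ('n, 'k) mpoly set \<Rightarrow> bool" where
  "cellular_resolution X J \<longleftrightarrow>
     (\<forall>v. {v} \<in> cells X \<longrightarrow> 0 \<le> vlabel X v) \<and>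
     J = ideal_span {xpow (\<lambda>i. nat (vlabel X v i)) | v. {v} \<in> cells X} \<and>
     free_resolution (cellular_complex X) J"

definition neg_unbounded :: "('p, 'n, 'k) cell_complex \<Rightarrow> 'p set set" where
  "neg_unbounded X = {F \<in> cells X. \<not> 1 \<le> face_label X F}"

definition relative_cocellular_complex ::
    "('p, 'n, 'k::field) cell_complex \<Rightarrow> 'p set set \<Rightarrow> ('p set, 'n, 'k) free_complex" where
  "relative_cocellular_complex X Y = dual_complex (quotient_complex (cellular_complex X) Y)"

end

theory Submission
  imports Defs
begin

text \<open>
  The proof computes the homology of the dual complex one multidegree at a time. In degree \<open>d\<close>
  the complex consists of the cochains on the cells \<open>F\<close> with
  \<open>a\<^sub>F \<succeq> e\<close>, where \<open>e\<close> is the join of \<open>1\<close> and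
  \<open>a + 1 - d\<close>: it computes the cohomology of \<open>X\<close> relative to the subcomplex of
  the cells with \<open>a\<^sub>F\<close> not \<open>\<succeq> e\<close>. This subcomplex is the union of the
  \<open>n\<close> subcomplexes \<open>X\<^sub>i\<close> of the cells whose \<open>i\<close>th label
  coordinate is less than \<open>e i\<close>.

  As \<open>X\<close> supports a resolution of the artinian ideal \<open>J = I + m_pow (a + 1)\<close>,
  the cells with label at most \<open>b\<close> form an acyclic complex if \<open>x\<close> to the
  \<open>b\<close> lies in \<open>J\<close>, and there are none otherwise. An intersection of fewer than
  \<open>n\<close> of the \<open>X\<^sub>i\<close> leaves a coordinate unbounded, so it is acyclic because
  \<open>J\<close> is artinian. The intersection of all \<open>X\<^sub>i\<close> belongs to the degree
  \<open>e - 1\<close>. If \<open>x\<close> to the \<open>e - 1\<close> lies in \<open>J\<close>, the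
  union is acyclic like \<open>X\<close> and the relative homology vanishes; otherwise the cover has the nerve
  of the boundary of a simplex, and the relative homology is one-dimensional in dimension
  \<open>n - 1\<close>. Since \<open>X\<close> has dimension \<open>n - 1\<close>, this is homological
  degree \<open>0\<close> of the shifted dual complex. So the dual complex resolves a module that has
  dimension one in the degrees \<open>d\<close> with \<open>x\<close> to the \<open>e - 1\<close> outside
  \<open>J\<close>, and zero elsewhere. For \<open>d \<succeq> 0\<close> the exponent \<open>e - 1\<close>
  is \<open>a - d\<close>, truncated at \<open>0\<close>, and \<open>in_alexander_dual_iff\<close> turns the
  condition into membership of \<open>x\<close> to the \<open>d\<close> in the Alexander dual; for the other
  \<open>d\<close> it fails.

  Dimensions do not determine the module structure. A single relative cycle \<open>z\<close> for
  \<open>e = 1\<close> is therefore shown to restrict to a generator of the relative homology for every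
  \<open>e\<close> at once (\<open>top_cycle\<close>). Pairing cochains with \<open>z\<close> is an
  \<open>S\<close>-linear homogeneous map from the degree \<open>0\<close> part of the dual complex to
  \<open>S\<close>, and by vector space duality in each multidegree
  (\<open>annihilator_of_common_kernel\<close>) its kernel consists of the boundaries and its image is the
  Alexander dual.

  Instead of covers and nerves, the computation cuts boxes of labels along coordinate hyperplanes
  (\<open>exact_box\<close>, \<open>generator_above\<close>). It uses the augmented cellular complex, with the
  empty face as a cell with label \<open>0\<close>.
\<close>

section \<open>Based chain complexes over a field\<close>

definition supported :: "'b set \<Rightarrow> ('b \<Rightarrow> 'k::zero) \<Rightarrow> bool" where
  "supported P v \<longleftrightarrow> (\<forall>b. v b \<noteq> 0 \<longrightarrow> b \<in> P)"

definition restr :: "'b set \<Rightarrow> ('b \<Rightarrow> 'k::zero) \<Rightarrow> 'b \<Rightarrow> 'k" where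
  "restr P v = (\<lambda>b. if b \<in> P then v b else 0)"

text \<open>
  \<open>D b b'\<close> is the coefficient of \<open>b'\<close> in the boundary of \<open>b\<close>. Both
  the argument and the value are cut down to \<open>P\<close>, so that \<open>bdry D P\<close> is the
  differential of the subquotient complex spanned by \<open>P\<close>.
\<close>

definition bdry :: "('b \<Rightarrow> 'b \<Rightarrow> 'k::field) \<Rightarrow> 'b set \<Rightarrow> ('b \<Rightarrow> 'k) \<Rightarrow> 'b \<Rightarrow> 'k" where
  "bdry D P v = restr P (\<lambda>b'. \<Sum>b\<in>P. v b * D b b')"

text \<open>
  Exactness is stated without reference to the homological degree: since the differential is homogeneous, this
  amounts to exactness in every degree.
\<close>

definition exact_on :: "('b \<Rightarrow> 'b \<Rightarrow> 'k::field) \<Rightarrow> 'b set \<Rightarrow> bool" where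
  "exact_on D P \<longleftrightarrow>
     (\<forall>v. supported P v \<and> bdry D P v = 0 \<longrightarrow> (\<exists>w. supported P w \<and> bdry D P w = v))"

definition square_zero :: "('b \<Rightarrow> 'b \<Rightarrow> 'k::field) \<Rightarrow> 'b set \<Rightarrow> bool" where
  "square_zero D P \<longleftrightarrow> (\<forall>a\<in>P. \<forall>c\<in>P. (\<Sum>b\<in>P. D a b * D b c) = 0)"

text \<open>
  The homology of the span of \<open>P\<close> is one-dimensional, concentrated in degree \<open>j\<close>,
  and generated by the class of the cycle \<open>z\<close>.
\<close>

definition homology_generator ::
    "('b \<Rightarrow> 'b \<Rightarrow> 'k::field) \<Rightarrow> ('b \<Rightarrow> int) \<Rightarrow> 'b set \<Rightarrow> int \<Rightarrow> ('b \<Rightarrow> 'k) \<Rightarrow> bool" where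
  "homology_generator D gr P j z \<longleftrightarrow>
     supported P z \<and> (\<forall>b. z b \<noteq> 0 \<longrightarrow> gr b = j) \<and> bdry D P z = 0 \<and>
     \<not> (\<exists>w. supported P w \<and> bdry D P w = z) \<and>
     (\<forall>v. supported P v \<and> bdry D P v = 0 \<longrightarrow>
        (\<exists>l w. supported P w \<and> v = (\<lambda>b. l * z b) + bdry D P w))"

lemma bdry_diff: "bdry D P (v - w) = bdry D P v - bdry D P w"
  by (auto simp: bdry_def restr_def fun_eq_iff left_diff_distrib sum_subtractf)

lemma bdry_scale: "bdry D P (\<lambda>b. l * v b) = (\<lambda>b. l * bdry D P v b)"
  by (auto simp: bdry_def restr_def fun_eq_iff sum_distrib_left mult.assoc)

lemma supported_diff: "supported P v \<Longrightarrow> supported P w \<Longrightarrow> supported P (v - w :: 'b \<Rightarrow> 'k::field)"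
  unfolding supported_def minus_apply by (metis diff_zero)

lemma supported_scale: "supported P v \<Longrightarrow> supported P (\<lambda>b. l * v b :: 'k::field)"
  by (auto simp: supported_def)

lemma supported_mono: "supported Q v \<Longrightarrow> Q \<subseteq> P \<Longrightarrow> supported P v"
  by (auto simp: supported_def)

lemma supported_bdry: "supported P (bdry D P v)"
  by (auto simp: supported_def bdry_def restr_def)

lemma supported_restr: "supported P (restr P v)"
  by (auto simp: supported_def restr_def)

lemma restr_id: "supported P v \<Longrightarrow> restr P v = v"
  by (auto simp: supported_def restr_def fun_eq_iff)

lemma bdry_bdry:
  assumes "finite P" "square_zero D P"
  shows "bdry D P (bdry D P v) = 0"
proof
  fix c
  have "(\<Sum>b\<in>P. (\<Sum>a\<in>P. v a * D a b) * D b c) = 0" if "c \<in> P"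
  proof -
    have "(\<Sum>b\<in>P. (\<Sum>a\<in>P. v a * D a b) * D b c) = (\<Sum>a\<in>P. v a * (\<Sum>b\<in>P. D a b * D b c))"
      by (simp add: sum_distrib_left sum_distrib_right mult.assoc) (rule sum.swap)
    also have "\<dots> = 0"
      using assms(2) that by (simp add: square_zero_def)
    finally show ?thesis .
  qed
  then show "bdry D P (bdry D P v) c = 0 c"
    by (simp add: bdry_def restr_def)
qed

lemma truncate_bdry:
  assumes "\<And>b b'. b \<in> P \<Longrightarrow> b' \<in> P \<Longrightarrow> D b b' \<noteq> 0 \<Longrightarrow> gr b' = gr b - (1 :: int)"
  shows "bdry D P (\<lambda>b. if gr b = j + 1 then v b else 0) =
    (\<lambda>b. if gr b = j then bdry D P v b else 0)"
proof
  fix b'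
  have "(\<Sum>b\<in>P. (if gr b = j + 1 then v b else 0) * D b b') =
      (if gr b' = j then \<Sum>b\<in>P. v b * D b b' else 0)" if b': "b' \<in> P"
  proof -
    have "(if gr b = j + 1 then v b else 0) * D b b' = (if gr b' = j then v b * D b b' else 0)"
      if "b \<in> P" for b
      using assms[OF that b'] by (cases "D b b' = 0") auto
    then show ?thesis by simp
  qed
  then show "bdry D P (\<lambda>b. if gr b = j + 1 then v b else 0) b' =
      (if gr b' = j then bdry D P v b' else 0)"
    by (simp add: bdry_def restr_def)
qed

text \<open>
  The short exact sequence
  \<open>0 \<rightarrow> Q \<rightarrow> P \<rightarrow> R \<rightarrow> 0\<close> of complexes
  spanned by sets of basis elements. The two lemmas \<open>exact_quotient\<close> and
  \<open>connecting_generator\<close> are what its long exact homology sequence says when \<open>P\<close> is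
  exact.
\<close>

locale complex_extension =
  fixes D :: "'b \<Rightarrow> 'b \<Rightarrow> 'k::field" and P Q R :: "'b set"
  assumes finite_P: "finite P" and square_zero_P: "square_zero D P"
    and union: "P = Q \<union> R" and disjoint: "Q \<inter> R = {}"
    and subcomplex: "b \<in> Q \<Longrightarrow> b' \<in> R \<Longrightarrow> D b b' = 0"
begin

lemma restr_bdry: "restr R (bdry D P v) = bdry D R (restr R v)"
proof -
  have "(\<Sum>b\<in>P. v b * D b b') = (\<Sum>b\<in>R. v b * D b b')" if "b' \<in> R" for b'
    by (rule sum.mono_neutral_right) (use finite_P union subcomplex that in auto)
  then show ?thesis
    using union by (auto simp: restr_def bdry_def fun_eq_iff)
qed

lemma bdry_on_subcomplex:
  assumes "supported Q v"
  shows "bdry D P v = bdry D Q v"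
proof
  fix b'
  have *: "(\<Sum>b\<in>P. v b * D b b') = (\<Sum>b\<in>Q. v b * D b b')"
    by (rule sum.mono_neutral_right) (use finite_P union assms in \<open>auto simp: supported_def\<close>)
  show "bdry D P v b' = bdry D Q v b'"
    unfolding bdry_def restr_def * using union subcomplex by auto
qed

text \<open>
  The connecting homomorphism: the boundary, taken in \<open>P\<close>, of a cycle of \<open>R\<close> is a
  cycle of \<open>Q\<close>.
\<close>

lemma boundary_of_quotient_cycle:
  assumes "bdry D R (restr R v) = 0"
  shows "supported Q (bdry D P v)" "bdry D Q (bdry D P v) = 0"
proof -
  have "restr R (bdry D P v) = 0"
    using assms by (simp add: restr_bdry)
  then show s: "supported Q (bdry D P v)"
    unfolding supported_def
  proof (intro allI impI)
    fix b assume "bdry D P v b \<noteq> 0"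
    then show "b \<in> Q"
      using union supported_bdry[of P D v] fun_cong[OF \<open>restr R (bdry D P v) = 0\<close>, of b]
      by (auto simp: supported_def restr_def)
  qed
  show "bdry D Q (bdry D P v) = 0"
    using bdry_on_subcomplex[OF s] bdry_bdry[OF finite_P square_zero_P] by metis
qed

lemma exact_quotient:
  assumes P: "exact_on D P" and Q: "exact_on D Q"
  shows "exact_on D R"
  unfolding exact_on_def
proof (intro allI impI, elim conjE)
  fix v assume v: "supported R v" "bdry D R v = 0"
  obtain w where w: "supported Q w" "bdry D Q w = bdry D P v"
    using Q boundary_of_quotient_cycle[of v] v by (auto simp: exact_on_def restr_id)
  have "bdry D P (v - w) = 0"
    using w by (simp add: bdry_diff bdry_on_subcomplex)
  moreover have "supported P (v - w)"
    using v w union by (auto intro!: supported_diff intro: supported_mono)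
  ultimately obtain y where y: "bdry D P y = v - w"
    using P unfolding exact_on_def by blast
  have "bdry D R (restr R y) = restr R (v - w)"
    using restr_bdry[of y] y by simp
  also have "\<dots> = v"
    using v w disjoint by (fastforce simp: restr_def supported_def fun_eq_iff)
  finally show "\<exists>w. supported R w \<and> bdry D R w = v"
    using supported_restr by blast
qed

lemma connecting_generator:
  assumes P: "exact_on D P" and Q: "homology_generator D gr Q j z"
    and gr: "\<And>b b'. b \<in> P \<Longrightarrow> b' \<in> P \<Longrightarrow> D b b' \<noteq> 0 \<Longrightarrow> gr b' = gr b - 1"
  shows "\<exists>z'. homology_generator D gr R (j + 1) z'"
proof -
  have z: "supported Q z" "\<And>b. z b \<noteq> 0 \<Longrightarrow> gr b = j" "bdry D Q z = 0"
    and z_no_bdry: "\<And>w. supported Q w \<Longrightarrow> bdry D Q w \<noteq> z"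
    and z_gen: "\<And>v. supported Q v \<Longrightarrow> bdry D Q v = 0 \<Longrightarrow>
        \<exists>l w. supported Q w \<and> v = (\<lambda>b. l * z b) + bdry D Q w"
    using Q unfolding homology_generator_def by blast+
  have "supported P z" "bdry D P z = 0"
    using z union bdry_on_subcomplex by (auto intro: supported_mono)
  then obtain y0 where y0: "supported P y0" "bdry D P y0 = z"
    using P unfolding exact_on_def by blast
  define y where "y = (\<lambda>b. if gr b = j + 1 then y0 b else 0)"
  have "bdry D P y = (\<lambda>b. if gr b = j then bdry D P y0 b else 0)"
    unfolding y_def by (rule truncate_bdry) (rule gr)
  also have "\<dots> = z"
    using z(2) by (auto simp: y0(2) fun_eq_iff)
  finally have "bdry D P y = z" .
  then have y: "supported P y" "bdry D P y = z" "\<And>b. y b \<noteq> 0 \<Longrightarrow> gr b = j + 1"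
    using y0(1) by (auto simp: y_def supported_def split: if_splits)
  have Rz: "restr R z = 0"
    using z(1) disjoint by (fastforce simp: supported_def restr_def fun_eq_iff)
  have "homology_generator D gr R (j + 1) (restr R y)"
    unfolding homology_generator_def
  proof (intro conjI allI impI supported_restr, goal_cases)
    case (1 b)
    then show ?case using y(3) by (auto simp: restr_def split: if_splits)
  next
    case 2
    then show ?case using restr_bdry[of y] y(2) Rz by simp
  next
    case 3
    show ?case
    proof
      assume "\<exists>w. supported R w \<and> bdry D R w = restr R y"
      then obtain w where w: "supported R w" "bdry D R w = restr R y" by blast
      have eq: "restr R (bdry D P w) = restr R y"
        using w restr_bdry[of w] by (simp add: restr_id)
      have "supported Q (y - bdry D P w)"
        unfolding supported_def
      proof (intro allI impI)
        fix b assume "(y - bdry D P w) b \<noteq> 0"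
        then show "b \<in> Q"
          using union y(1) supported_bdry[of P D w]
            fun_cong[OF eq, of b]
          by (cases "y b = 0") (auto simp: supported_def restr_def split: if_splits)
      qed
      moreover from this have "bdry D Q (y - bdry D P w) = z"
        using bdry_on_subcomplex y(2) bdry_bdry[OF finite_P square_zero_P]
        by (metis bdry_diff diff_zero)
      ultimately show False
        using z_no_bdry by blast
    qed
  next
    case (4 v)
    then have v: "supported R v" "bdry D R v = 0" by auto
    have "supported Q (bdry D P v)" "bdry D Q (bdry D P v) = 0"
      using boundary_of_quotient_cycle[of v] v by (simp_all add: restr_id)
    then obtain l w where w: "supported Q w" "bdry D P v = (\<lambda>b. l * z b) + bdry D Q w"
      using z_gen by blast
    define x where "x = v - w - (\<lambda>b. l * y b)"
    have "bdry D P x = 0"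
      using w y(2) by (simp add: x_def bdry_diff bdry_scale bdry_on_subcomplex)
    moreover have "supported P x"
      using v w y(1) union unfolding x_def
      by (auto intro!: supported_diff supported_scale intro: supported_mono)
    ultimately obtain t where t: "bdry D P t = x"
      using P unfolding exact_on_def by blast
    have "restr R x = v - (\<lambda>b. l * restr R y b)"
      using v(1) w(1) disjoint by (fastforce simp: x_def restr_def supported_def fun_eq_iff)
    then have "v = (\<lambda>b. l * restr R y b) + bdry D R (restr R t)"
      using restr_bdry[of t] t by (simp add: algebra_simps)
    then show ?case
      using supported_restr by blast
  qed
  then show ?thesis by blast
qed

end

text \<open>
  A functional that vanishes on the common kernel of finitely many functionals is a linear combination of
  them. Applied to the columns of a boundary matrix: a cochain vanishing on all cycles is a coboundary. The
  induction removes one functional \<open>A _ c\<close> at a time; if it does not already vanish on the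
  common kernel of the others, a multiple of it is subtracted from \<open>f\<close> to make \<open>f\<close>
  vanish there.
\<close>

lemma annihilator_of_common_kernel:
  fixes A :: "'b \<Rightarrow> 'c \<Rightarrow> 'k::field"
  assumes "finite P" "finite Q"
    and "\<And>v. (\<And>c. c \<in> Q \<Longrightarrow> (\<Sum>b\<in>P. v b * A b c) = 0) \<Longrightarrow> (\<Sum>b\<in>P. v b * f b) = 0"
  shows "\<exists>g. \<forall>b\<in>P. f b = (\<Sum>c\<in>Q. g c * A b c)"
  using assms(2,3)
proof (induction Q arbitrary: f rule: finite_induct)
  case empty
  have "f b = 0" if "b \<in> P" for b
  proof -
    have "(\<Sum>b'\<in>P. (if b' = b then 1 else 0) * f b') = 0"
      by (rule empty.prems) simp
    then show ?thesis
      using that assms(1) by (simp add: if_distrib[where f = "\<lambda>x. x * _"] cong: if_cong)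
  qed
  then show ?case by simp
next
  case (insert c Q)
  show ?case
  proof (cases "\<exists>v. (\<forall>c'\<in>Q. (\<Sum>b\<in>P. v b * A b c') = 0) \<and> (\<Sum>b\<in>P. v b * A b c) \<noteq> 0")
    case False
    then have "\<exists>g. \<forall>b\<in>P. f b = (\<Sum>c\<in>Q. g c * A b c)"
      by (intro insert.IH insert.prems) auto
    then obtain g where "\<forall>b\<in>P. f b = (\<Sum>c\<in>Q. g c * A b c)" ..
    then have "\<forall>b\<in>P. f b = (\<Sum>c'\<in>insert c Q. (g(c := 0)) c' * A b c')"
      using insert.hyps by (auto intro!: sum.cong)
    then show ?thesis by blast
  next
    case True
    then obtain v0 where v0: "\<And>c'. c' \<in> Q \<Longrightarrow> (\<Sum>b\<in>P. v0 b * A b c') = 0"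
      and v0c: "(\<Sum>b\<in>P. v0 b * A b c) \<noteq> 0" by blast
    define m where "m = (\<Sum>b\<in>P. v0 b * f b) / (\<Sum>b\<in>P. v0 b * A b c)"
    have "\<exists>g. \<forall>b\<in>P. f b - m * A b c = (\<Sum>c\<in>Q. g c * A b c)"
    proof (rule insert.IH)
      fix v assume v: "\<And>c. c \<in> Q \<Longrightarrow> (\<Sum>b\<in>P. v b * A b c) = 0"
      define t where "t = (\<Sum>b\<in>P. v b * A b c) / (\<Sum>b\<in>P. v0 b * A b c)"
      have lin: "(\<Sum>b\<in>P. (v b - t * v0 b) * h b) = (\<Sum>b\<in>P. v b * h b) - t * (\<Sum>b\<in>P. v0 b * h b)"
        for h
        by (simp add: left_diff_distrib sum_subtractf sum_distrib_left mult.assoc)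
      have "(\<Sum>b\<in>P. (v b - t * v0 b) * f b) = 0"
      proof (rule insert.prems)
        fix c' assume "c' \<in> insert c Q"
        then show "(\<Sum>b\<in>P. (v b - t * v0 b) * A b c') = 0"
          unfolding lin using v v0 v0c by (auto simp: t_def)
      qed
      then have "(\<Sum>b\<in>P. v b * f b) = t * (\<Sum>b\<in>P. v0 b * f b)"
        unfolding lin by simp
      moreover have "(\<Sum>b\<in>P. v b * (f b - m * A b c)) =
          (\<Sum>b\<in>P. v b * f b) - m * (\<Sum>b\<in>P. v b * A b c)"
        by (simp add: right_diff_distrib sum_subtractf sum_distrib_left mult.left_commute)
      ultimately show "(\<Sum>b\<in>P. v b * (f b - m * A b c)) = 0"
        by (simp add: t_def m_def)
    qed
    then obtain g where g: "\<forall>b\<in>P. f b - m * A b c = (\<Sum>c\<in>Q. g c * A b c)" ..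
    have "(\<Sum>c'\<in>Q. (g(c := m)) c' * A b c') = (\<Sum>c'\<in>Q. g c' * A b c')" for b
      using insert.hyps by (intro sum.cong) auto
    then have "\<forall>b\<in>P. f b = (\<Sum>c'\<in>insert c Q. (g(c := m)) c' * A b c')"
      using insert.hyps g by (simp add: algebra_simps)
    then show ?thesis by blast
  qed
qed

section \<open>Homology of boxes of labels\<close>

lemma exact_on_empty: "exact_on D {}"
  by (auto simp: exact_on_def supported_def bdry_def restr_def fun_eq_iff)

text \<open>
  A complex of vector spaces whose basis elements carry nonnegative multidegrees that do not increase along
  the differential. Any set of basis elements cut out by lower and upper bounds on the labels then spans a
  subquotient complex.
\<close>

locale labelled_complex =
  fixes B :: "'b set" and D :: "'b \<Rightarrow> 'b \<Rightarrow> 'k::field"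
    and gr :: "'b \<Rightarrow> int" and lab :: "'b \<Rightarrow> 'n::finite \<Rightarrow> int"
  assumes finite_B: "finite B"
    and square_zero_B: "square_zero D B"
    and gr_face: "b \<in> B \<Longrightarrow> b' \<in> B \<Longrightarrow> D b b' \<noteq> 0 \<Longrightarrow> gr b' = gr b - 1"
    and lab_face: "b \<in> B \<Longrightarrow> b' \<in> B \<Longrightarrow> D b b' \<noteq> 0 \<Longrightarrow> lab b' \<le> lab b"
    and lab_nonneg: "b \<in> B \<Longrightarrow> 0 \<le> lab b"
begin

definition box :: "('n \<Rightarrow> int) \<Rightarrow> ('n \<Rightarrow> int) \<Rightarrow> 'b set" where
  "box l u = {b \<in> B. \<forall>i. l i \<le> lab b i \<and> lab b i < u i}"

lemma square_zero_subset:
  assumes P: "P \<subseteq> B"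
    and convex: "\<And>a b c. a \<in> P \<Longrightarrow> c \<in> P \<Longrightarrow> b \<in> B \<Longrightarrow> D a b \<noteq> 0 \<Longrightarrow> D b c \<noteq> 0 \<Longrightarrow> b \<in> P"
  shows "square_zero D P"
  unfolding square_zero_def
proof (intro ballI)
  fix a c assume ac: "a \<in> P" "c \<in> P"
  have "(\<Sum>b\<in>P. D a b * D b c) = (\<Sum>b\<in>B. D a b * D b c)"
  proof (rule sum.mono_neutral_left)
    show "\<forall>b\<in>B - P. D a b * D b c = 0"
      using convex[OF ac] by auto
  qed (use finite_B P in auto)
  also have "\<dots> = 0"
    using ac P square_zero_B by (auto simp: square_zero_def)
  finally show "(\<Sum>b\<in>P. D a b * D b c) = 0" .
qed

lemma square_zero_box: "square_zero D (box l u)"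
proof (rule square_zero_subset)
  fix a b c assume ac: "a \<in> box l u" "c \<in> box l u" and b: "b \<in> B" "D a b \<noteq> 0" "D b c \<noteq> 0"
  then have "lab b \<le> lab a" "lab c \<le> lab b"
    by (auto simp: box_def intro: lab_face)
  then have "\<forall>i. lab b i \<le> lab a i \<and> lab c i \<le> lab b i"
    by (auto simp: le_fun_def)
  then show "b \<in> box l u"
    using ac b unfolding box_def by (auto intro: order_trans le_less_trans)
qed (auto simp: box_def)

text \<open>
  A primitive of \<open>v\<close> is glued from primitives \<open>W j\<close> of its homogeneous parts. The
  part of degree \<open>j\<close> only needs the part of \<open>W j\<close> in degree \<open>j + 1\<close>,
  which is why \<open>W (gr b - 1) b\<close> is the right coefficient.
\<close>

lemma exact_on_gradedI:
  assumes P: "P \<subseteq> B"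
    and exact: "\<And>j v. supported P v \<Longrightarrow> (\<And>b. v b \<noteq> 0 \<Longrightarrow> gr b = j) \<Longrightarrow> bdry D P v = 0 \<Longrightarrow>
      \<exists>w. supported P w \<and> bdry D P w = v"
  shows "exact_on D P"
  unfolding exact_on_def
proof (intro allI impI, elim conjE)
  have gr_P: "gr b' = gr b - 1" if "b \<in> P" "b' \<in> P" "D b b' \<noteq> 0" for b b'
    using that P by (intro gr_face) auto
  fix v assume v: "supported P v" "bdry D P v = 0"
  have "\<exists>w. supported P w \<and> bdry D P w = (\<lambda>b. if gr b = j then v b else 0)" for j
  proof (rule exact[of _ j])
    show "bdry D P (\<lambda>b. if gr b = j then v b else 0) = 0"
      using truncate_bdry[of P D gr "j - 1" v] gr_P v(2) by (simp add: fun_eq_iff)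
  qed (use v(1) in \<open>auto simp: supported_def split: if_splits\<close>)
  then obtain W where W: "\<And>j. supported P (W j)"
    "\<And>j. bdry D P (W j) = (\<lambda>b. if gr b = j then v b else 0)"
    by metis
  define w where "w b = W (gr b - 1) b" for b
  have "bdry D P w b' = v b'" for b'
  proof (cases "b' \<in> P")
    case True
    have "w b * D b b' = W (gr b') b * D b b'" if "b \<in> P" for b
      using gr_P[OF that True] by (cases "D b b' = 0") (auto simp: w_def)
    then have "(\<Sum>b\<in>P. w b * D b b') = (\<Sum>b\<in>P. W (gr b') b * D b b')"
      by (intro sum.cong refl)
    then show ?thesis
      using fun_cong[OF W(2)[of "gr b'"], of b'] True by (simp add: bdry_def restr_def)
  next
    case False
    then show ?thesis using v(1) by (auto simp: bdry_def restr_def supported_def)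
  qed
  then have "bdry D P w = v" by blast
  moreover have "supported P w"
    using W(1) by (auto simp: supported_def w_def)
  ultimately show "\<exists>w. supported P w \<and> bdry D P w = v" by blast
qed

text \<open>
  Cutting the box at height \<open>l i\<close> in the direction \<open>i\<close>: the lower slab is a
  subcomplex, since labels do not increase, and \<open>box l u\<close> is the quotient.
\<close>

lemma box_extension:
  assumes "l i \<le> u i" and "0 \<le> l i"
  shows "complex_extension D (box (l(i := 0)) u) (box (l(i := 0)) (u(i := l i))) (box l u)"
proof
  show "finite (box (l(i := 0)) u)"
    using finite_B by (auto simp: box_def)
  show "square_zero D (box (l(i := 0)) u)"
    by (rule square_zero_box)
  show "box (l(i := 0)) u = box (l(i := 0)) (u(i := l i)) \<union> box l u"
    using assms lab_nonneg unfolding box_def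
    by (auto simp: le_fun_def split: if_splits)
  show "box (l(i := 0)) (u(i := l i)) \<inter> box l u = {}"
    by (auto simp: box_def) (metis linorder_not_le)
  show "D b b' = 0" if "b \<in> box (l(i := 0)) (u(i := l i))" "b' \<in> box l u" for b b'
  proof (rule ccontr)
    assume "D b b' \<noteq> 0"
    then have "lab b' i \<le> lab b i"
      using that lab_face by (auto simp: box_def le_fun_def)
    moreover have "lab b i < l i" "l i \<le> lab b' i"
      using that by (auto simp: box_def dest: spec[of _ i])
    ultimately show False by simp
  qed
qed

text \<open>
  Cutting in each direction of \<open>S\<close> in turn expresses \<open>box l u\<close> through boxes that
  have no lower bound in these directions. This plays the role of the Mayer--Vietoris argument for the cover
  of the complement of the cells with label \<open>\<succeq> l\<close>.
\<close>

lemma exact_box: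
  assumes "finite S" "l \<le> u" "0 \<le> l"
    and "\<And>T. T \<subseteq> S \<Longrightarrow>
      exact_on D (box (\<lambda>i. if i \<in> S then 0 else l i) (\<lambda>i. if i \<in> T then l i else u i))"
  shows "exact_on D (box l u)"
  using assms
proof (induction S arbitrary: l u rule: finite_induct)
  case empty
  then show ?case by (simp add: empty.prems(3)[of "{}", simplified])
next
  case (insert i S)
  interpret complex_extension D "box (l(i := 0)) u" "box (l(i := 0)) (u(i := l i))" "box l u"
    using insert.prems by (intro box_extension) (auto simp: le_fun_def)
  have l: "(\<lambda>j. if j \<in> S then 0 else (l(i := 0)) j) = (\<lambda>j. if j \<in> insert i S then 0 else l j)"
    by auto
  show ?case
  proof (rule exact_quotient)
    show "exact_on D (box (l(i := 0)) u)"
    proof (rule insert.IH)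
      fix T assume "T \<subseteq> S"
      moreover from this have
        "(\<lambda>j. if j \<in> T then (l(i := 0)) j else u j) = (\<lambda>j. if j \<in> T then l j else u j)"
        using insert.hyps by (auto simp: fun_eq_iff)
      ultimately show "exact_on D (box (\<lambda>j. if j \<in> S then 0 else (l(i := 0)) j)
          (\<lambda>j. if j \<in> T then (l(i := 0)) j else u j))"
        unfolding l using insert.prems(3)[of T] by auto
    qed (use insert.prems in \<open>auto simp: le_fun_def intro: order_trans\<close>)
    show "exact_on D (box (l(i := 0)) (u(i := l i)))"
    proof (rule insert.IH)
      fix T assume "T \<subseteq> S"
      moreover from this have
        "(\<lambda>j. if j \<in> T then (l(i := 0)) j else (u(i := l i)) j) =
          (\<lambda>j. if j \<in> insert i T then l j else u j)"
        using insert.hyps by (auto simp: fun_eq_iff)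
      ultimately show "exact_on D (box (\<lambda>j. if j \<in> S then 0 else (l(i := 0)) j)
          (\<lambda>j. if j \<in> T then (l(i := 0)) j else (u(i := l i)) j))"
        unfolding l using insert.prems(3)[of "insert i T"] by auto
    qed (use insert.prems in \<open>auto simp: le_fun_def intro: order_trans\<close>)
  qed
qed

end

text \<open>
  The augmented cellular complex of a resolution of an artinian monomial ideal, reduced to what the homology
  computation needs. \<open>emp\<close> is the empty face, \<open>J\<close> the set of multidegrees of the
  monomials of the ideal, and the ideal contains the powers \<open>x\<^sub>i\<close> to the
  \<open>N i + 1\<close>. The faces with label at most \<open>d\<close> compute the strand of the augmented
  resolution in degree \<open>d\<close>: it is exact in degrees of the ideal, and below any other degree there
  is only the empty face.
\<close>

locale artinian_complex = labelled_complex B D gr lab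
  for B :: "'b set" and D :: "'b \<Rightarrow> 'b \<Rightarrow> 'k::field"
    and gr :: "'b \<Rightarrow> int" and lab :: "'b \<Rightarrow> 'n::finite \<Rightarrow> int" +
  fixes emp :: 'b and J :: "('n \<Rightarrow> int) set" and N :: "'n \<Rightarrow> int"
  assumes emp: "emp \<in> B" "lab emp = 0" "gr emp = -1"
    and exact_down: "0 \<le> d \<Longrightarrow> d \<in> J \<Longrightarrow> exact_on D {b \<in> B. lab b \<le> d}"
    and bare_down: "0 \<le> d \<Longrightarrow> d \<notin> J \<Longrightarrow> {b \<in> B. lab b \<le> d} = {emp}"
    and J_up: "d \<in> J \<Longrightarrow> d \<le> d' \<Longrightarrow> d' \<in> J"
    and J_artinian: "0 \<le> d \<Longrightarrow> N i < d i \<Longrightarrow> d \<in> J"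
    and J_proper: "0 \<notin> J"
    and gr_le: "b \<in> B \<Longrightarrow> gr b \<le> int CARD('n) - 1"
begin

lemma exists_upper_bound:
  obtains U where "e \<le> U" "\<And>b i. b \<in> B \<Longrightarrow> lab b i < U i" "\<And>i. N i < U i - 1"
proof
  define U where "U i = Max (insert (e i) (insert (N i + 2) ((\<lambda>b. lab b i + 1) ` B)))" for i
  have le: "x \<le> U i" if "x \<in> insert (e i) (insert (N i + 2) ((\<lambda>b. lab b i + 1) ` B))" for x i
    unfolding U_def using finite_B that by (intro Max_ge) auto
  show "e \<le> U" using le by (auto simp: le_fun_def)
  show "lab b i < U i" if "b \<in> B" for b i using le[of "lab b i + 1" i] that by auto
  show "N i < U i - 1" for i using le[of "N i + 2" i] by auto
qed

lemma down_box: "box 0 u = {b \<in> B. lab b \<le> u - 1}"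
  using lab_nonneg by (auto simp: box_def le_fun_def) 

lemma exact_down_box: "1 \<le> u \<Longrightarrow> u - 1 \<in> J \<Longrightarrow> exact_on D (box 0 u)"
  unfolding down_box by (rule exact_down) (auto simp: le_fun_def int_one_le_iff_zero_less)

lemma bare_down_box: "1 \<le> u \<Longrightarrow> u - 1 \<notin> J \<Longrightarrow> box 0 u = {emp}"
  unfolding down_box by (rule bare_down) (auto simp: le_fun_def int_one_le_iff_zero_less)

lemma J_large: "1 \<le> u \<Longrightarrow> N i < u i - 1 \<Longrightarrow> u - 1 \<in> J"
  by (rule J_artinian[of _ i]) (auto simp: le_fun_def int_one_le_iff_zero_less)

definition above :: "('n \<Rightarrow> int) \<Rightarrow> 'b set" where
  "above e = {b \<in> B. e \<le> lab b}"

lemma box_above: "(\<And>b i. b \<in> B \<Longrightarrow> lab b i < U i) \<Longrightarrow> box e U = above e"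
  by (auto simp: box_def above_def le_fun_def)

text \<open>
  All the boxes without lower bounds that arise are strands in degrees of \<open>J\<close>: their upper bounds
  dominate \<open>e\<close>.
\<close>

lemma exact_above:
  assumes "1 \<le> e" "e - 1 \<in> J"
  shows "exact_on D (above e)"
proof -
  obtain U where U: "e \<le> U" "\<And>b i. b \<in> B \<Longrightarrow> lab b i < U i" "\<And>i. N i < U i - 1"
    using exists_upper_bound[of e] by blast
  have "exact_on D (box e U)"
  proof (rule exact_box[of UNIV])
    fix T :: "'n set"
    define u where "u = (\<lambda>i. if i \<in> T then e i else U i)"
    have u: "e \<le> u" using U(1) by (auto simp: u_def le_fun_def)
    have "e - 1 \<le> u - 1"
    proof (rule le_funI)
      show "(e - 1) i \<le> (u - 1) i" for i
        using le_funD[OF u, of i] by simp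
    qed
    then have "exact_on D (box 0 u)"
      using assms u J_up by (intro exact_down_box) auto
    then show "exact_on D (box (\<lambda>i. if i \<in> UNIV then 0 else e i) (\<lambda>i. if i \<in> T then e i else U i))"
      by (simp add: u_def zero_fun_def)
  next
    show "0 \<le> e" using assms(1) by (auto simp: le_fun_def intro: order_trans[of _ 1])
  qed (use U in auto)
  then show ?thesis using box_above[of U e] U(2) by simp
qed

text \<open>
  Start from the strand in degree \<open>e - 1\<close>, which consists of the empty face alone and hence has
  one-dimensional homology in degree \<open>-1\<close>. Turning the upper bound \<open>e i\<close> into a
  lower bound, one direction after the other, raises the degree of the homology by one each time: the union of
  the boxes before and after the change is exact, because it is built from strands unbounded in direction
  \<open>i\<close>, whose degrees belong to the artinian ideal.
\<close>

lemma generator_above: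
  assumes e: "1 \<le> e" "e - 1 \<notin> J"
  shows "\<exists>z. homology_generator D gr (above e) (int CARD('n) - 1) z"
proof -
  obtain U where U: "e \<le> U" "\<And>b i. b \<in> B \<Longrightarrow> lab b i < U i" "\<And>i. N i < U i - 1"
    using exists_upper_bound[of e] by blast
  have e1: "1 \<le> e i" and eU: "e i \<le> U i" for i
    using e(1) U(1) by (auto simp: le_fun_def)
  have e0: "0 \<le> e i" for i
    using order_trans[OF zero_le_one e1] .
  let ?box = "\<lambda>S. box (\<lambda>i. if i \<in> S then e i else 0) (\<lambda>i. if i \<in> S then U i else e i)"
  have "\<exists>z. homology_generator D gr (?box S) (int (card S) - 1) z" if "finite S" for S :: "'n set"
    using that
  proof (induction S rule: finite_induct)
    case empty
    have "?box {} = {emp}"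
      using bare_down_box[OF e] by (simp add: zero_fun_def)
    moreover have D0: "D emp emp = 0"
      using gr_face[of emp emp] emp(1) by auto
    then have b0: "bdry D {emp} v = 0" for v
      by (auto simp: bdry_def restr_def fun_eq_iff)
    have "homology_generator D gr {emp} (-1) (\<lambda>b. if b = emp then 1 else 0)"
      unfolding homology_generator_def b0
    proof (intro conjI allI impI notI; (elim exE conjE)?)
      show "supported {emp} (\<lambda>b. if b = emp then 1 else 0 :: 'k)"
        by (auto simp: supported_def)
      show "False" if "0 = (\<lambda>b. if b = emp then 1 else (0 :: 'k))"
        using fun_cong[OF that, of emp] by simp
      fix v :: "'b \<Rightarrow> 'k" assume "supported {emp} v"
      then have "v = (\<lambda>b. v emp * (if b = emp then 1 else 0)) + 0"
        by (auto simp: supported_def fun_eq_iff)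
      moreover have "supported {emp} (0 :: 'b \<Rightarrow> 'k)" by (simp add: supported_def)
      ultimately show "\<exists>l w. supported {emp} (w :: 'b \<Rightarrow> 'k) \<and> v = (\<lambda>b. l * (if b = emp then 1 else 0)) + 0"
        by blast
    qed (auto simp: emp split: if_splits)
    ultimately show ?case by auto
  next
    case (insert i S)
    let ?l = "\<lambda>j. if j \<in> insert i S then e j else 0"
    let ?u = "\<lambda>j. if j \<in> insert i S then U j else e j"
    interpret complex_extension D "box (?l(i := 0)) ?u" "box (?l(i := 0)) (?u(i := ?l i))" "box ?l ?u"
      using e1[of i] eU[of i] by (intro box_extension) auto
    have l: "?l(i := 0) = (\<lambda>j. if j \<in> S then e j else 0)"
      and u: "?u(i := ?l i) = (\<lambda>j. if j \<in> S then U j else e j)"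
      using insert.hyps by auto
    obtain z where "homology_generator D gr (?box S) (int (card S) - 1) z"
      using insert.IH by blast
    then have z: "homology_generator D gr (box (?l(i := 0)) (?u(i := ?l i))) (int (card S) - 1) z"
      by (simp only: l u)
    have "exact_on D (box (?l(i := 0)) ?u)"
    proof (rule exact_box[of S])
      fix T assume T: "T \<subseteq> S"
      define w where "w = (\<lambda>j. if j \<in> T then e j else ?u j)"
      have "1 \<le> w" using e1 eU by (auto simp: w_def le_fun_def intro: order_trans)
      moreover have "w i = U i" using T insert.hyps by (auto simp: w_def)
      ultimately have "exact_on D (box 0 w)"
        using U(3)[of i] by (intro exact_down_box J_large[of _ i]) auto
      moreover have "(\<lambda>j. if j \<in> S then 0 else (?l(i := 0)) j) = 0"
        by (auto simp: fun_eq_iff)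
      moreover have "(\<lambda>j. if j \<in> T then (?l(i := 0)) j else ?u j) = w"
        using T insert.hyps by (auto simp: w_def fun_eq_iff)
      ultimately show "exact_on D (box (\<lambda>j. if j \<in> S then 0 else (?l(i := 0)) j)
          (\<lambda>j. if j \<in> T then (?l(i := 0)) j else ?u j))"
        by simp
    next
      show "?l(i := 0) \<le> ?u" "0 \<le> ?l(i := 0)"
        using eU e0 order_trans[OF e0 eU] by (auto simp: le_fun_def)
    qed (use insert.hyps in auto)
    then have "\<exists>z'. homology_generator D gr (box ?l ?u) (int (card S) - 1 + 1) z'"
      using z by (rule connecting_generator) (auto simp: box_def intro: gr_face)
    then show ?case using insert.hyps by simp
  qed
  from this[of UNIV] have "\<exists>z. homology_generator D gr (box e U) (int CARD('n) - 1) z"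
    by simp
  then show ?thesis using box_above[of U e] U(2) by simp
qed

text \<open>
  This slab is the kernel of the passage from \<open>above e\<close> to \<open>above (e(i := m))\<close>.
  Strands that are unbounded in some direction other than \<open>i\<close> are exact; the only other strands
  have upper bounds \<open>e\<close> and \<open>e(i := m)\<close>, both consist of the empty face, and their
  difference is empty.
\<close>

lemma exact_slab:
  assumes e: "1 \<le> e" and m: "e i \<le> m" and J: "e(i := m) - 1 \<notin> J"
  shows "exact_on D {b \<in> above e. lab b i < m}"
proof -
  obtain U where U: "e \<le> U" "\<And>b i. b \<in> B \<Longrightarrow> lab b i < U i" "\<And>i. N i < U i - 1"
    using exists_upper_bound[of e] by blast
  have e1: "1 \<le> e j" and eU: "e j \<le> U j" for j
    using e U(1) by (auto simp: le_fun_def)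
  have "exact_on D (box e (U(i := m)))"
  proof (rule exact_box[of "- {i}"])
    fix T assume T: "T \<subseteq> - {i}"
    define l where "l = (\<lambda>j. if j \<in> - {i} then 0 else e j)"
    define u where "u = (\<lambda>j. if j \<in> T then e j else (U(i := m)) j)"
    have li: "l i = e i" "l(i := 0) = 0" and ui: "u i = m"
      using T by (auto simp: l_def u_def fun_eq_iff)
    have u1: "1 \<le> u" "1 \<le> u(i := e i)"
      using e1 eU m order_trans[OF e1] by (auto simp: u_def le_fun_def)
    have "exact_on D (box l u)"
    proof (cases "T = - {i}")
      case True
      have "u = e(i := m)" using True by (auto simp: u_def fun_eq_iff)
      then have "box 0 u = {emp}" using J u1 by (intro bare_down_box) auto
      moreover have "box l u \<subseteq> box 0 u"
        using lab_nonneg by (auto simp: box_def le_fun_def)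
      moreover have "emp \<notin> box l u"
      proof
        assume "emp \<in> box l u"
        then have "l i \<le> lab emp i" by (simp add: box_def)
        then show False using e1[of i] by (simp add: emp li)
      qed
      ultimately have "box l u = {}"
        using subset_singletonD[of "box l u" emp] by auto
      then show ?thesis by (simp add: exact_on_empty)
    next
      case False
      then obtain j where j: "j \<noteq> i" "j \<notin> T" using T by blast
      then have uj: "u j = U j" by (simp add: u_def)
      interpret complex_extension D "box (l(i := 0)) u" "box (l(i := 0)) (u(i := l i))" "box l u"
        using e1[of i] m by (intro box_extension) (auto simp: li ui)
      show ?thesis
        by (rule exact_quotient; unfold li; rule exact_down_box)
          (use u1 uj j U(3)[of j] in \<open>auto intro!: J_large[of _ j]\<close>)
    qed
    then show "exact_on D (box (\<lambda>j. if j \<in> - {i} then 0 else e j)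
        (\<lambda>j. if j \<in> T then e j else (U(i := m)) j))"
      by (simp add: l_def u_def)
  next
    show "e \<le> U(i := m)" "0 \<le> e"
      using e1 eU m by (auto simp: le_fun_def intro: order_trans[OF _ e1])
  qed auto
  moreover have "box e (U(i := m)) = {b \<in> above e. lab b i < m}"
    using U(2) by (auto simp: box_def above_def le_fun_def)
  ultimately show ?thesis by simp
qed

text \<open>
  There is nothing in degree \<open>CARD('n)\<close> whose boundary a top-dimensional chain could be.
\<close>

lemma top_boundary_zero:
  assumes "P \<subseteq> B" "\<And>b. v b \<noteq> 0 \<Longrightarrow> gr b = int CARD('n) - 1" "bdry D P w = v"
  shows "v = 0"
proof
  fix b'
  have "bdry D P w b' = 0" if gr': "gr b' = int CARD('n) - 1"
  proof -
    have "D b b' = 0" if "b \<in> P" "b' \<in> P" for b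
      using gr_face[of b b'] gr_le[of b] assms(1) that gr' by fastforce
    then show ?thesis by (auto simp: bdry_def restr_def)
  qed
  then show "v b' = 0 b'" using assms(2,3) by force
qed

lemma above_extension:
  assumes "e \<le> e'"
  shows "complex_extension D (above e) (above e - above e') (above e')"
proof
  show "finite (above e)" using finite_B by (auto simp: above_def)
  obtain U where U: "e \<le> U" "\<And>b i. b \<in> B \<Longrightarrow> lab b i < U i" "\<And>i. N i < U i - 1"
    using exists_upper_bound[of e] by blast
  show "square_zero D (above e)"
    using square_zero_box[of e U] box_above[of U e] U(2) by simp
  show "above e = above e - above e' \<union> above e'"
    using assms by (auto simp: above_def)
  show "D b b' = 0" if "b \<in> above e - above e'" "b' \<in> above e'" for b b'
  proof (rule ccontr)
    assume "D b b' \<noteq> 0"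
    then have "lab b' \<le> lab b" using that by (intro lab_face) (auto simp: above_def)
    then show False using that by (auto simp: above_def)
  qed
qed auto

text \<open>
  One cycle \<open>z\<close>, relative to the cells with label not \<open>\<succeq> 1\<close>, generates the
  relative homology for all corners \<open>e\<close> at the same time. That its restrictions do not vanish
  when \<open>e - 1\<close> lies outside \<open>J\<close> is seen by raising the coordinates of the corner
  from \<open>1\<close> to \<open>e\<close> one by one: if the restriction first vanished after one of these
  steps, the restriction before it would be a top-dimensional cycle in an exact slab, hence zero.
\<close>

lemma top_cycle:
  obtains z where
    "\<And>b. z b \<noteq> 0 \<Longrightarrow> b \<in> above 1 \<and> gr b = int CARD('n) - 1"
    "\<And>e. 1 \<le> e \<Longrightarrow> bdry D (above e) (restr (above e) z) = 0"
    "\<And>e. 1 \<le> e \<Longrightarrow> restr (above e) z = 0 \<longleftrightarrow> e - 1 \<in> J"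
    "\<And>e v. 1 \<le> e \<Longrightarrow> supported (above e) v \<Longrightarrow> bdry D (above e) v = 0 \<Longrightarrow>
      \<exists>l w. supported (above e) w \<and> v = (\<lambda>b. l * restr (above e) z b) + bdry D (above e) w"
proof -
  obtain z where z: "homology_generator D gr (above 1) (int CARD('n) - 1) z"
    using generator_above[of 1] J_proper by auto
  have supp: "b \<in> above 1 \<and> gr b = int CARD('n) - 1" if "z b \<noteq> 0" for b
    using z that by (auto simp: homology_generator_def supported_def)
  have z_ne: "z \<noteq> 0"
  proof
    assume "z = 0"
    moreover have "bdry D (above 1) 0 = 0"
      by (auto simp: bdry_def restr_def fun_eq_iff)
    moreover have "supported (above 1) (0 :: 'b \<Rightarrow> 'k)"
      by (simp add: supported_def)
    ultimately show False using z by (auto simp: homology_generator_def)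
  qed
  have cycle: "bdry D (above e) (restr (above e) z) = 0" if e: "1 \<le> e" for e
  proof -
    interpret complex_extension D "above 1" "above 1 - above e" "above e"
      by (rule above_extension[OF e])
    have "restr (above e) (bdry D (above 1) z) = 0"
      using z by (simp add: homology_generator_def restr_def zero_fun_def)
    then show ?thesis by (simp add: restr_bdry)
  qed
  have top: "gr b = int CARD('n) - 1" if "restr (above e) z b \<noteq> 0" for e b
    using that supp by (auto simp: restr_def split: if_splits)
  have zero: "restr (above e) z = 0" if e: "1 \<le> e" "e - 1 \<in> J" for e
  proof -
    obtain w where "bdry D (above e) w = restr (above e) z"
      using exact_above[OF e] cycle[OF e(1)] supported_restr unfolding exact_on_def by blast
    then show ?thesis
      by (intro top_boundary_zero[of "above e" _ w] top) (auto simp: above_def)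
  qed
  have nonzero: "restr (above e) z \<noteq> 0" if e: "1 \<le> e" "e - 1 \<notin> J" for e
  proof -
    have e1: "1 \<le> e i" for i using e(1) by (auto simp: le_fun_def)
    have "restr (above (\<lambda>i. if i \<in> S then e i else 1)) z \<noteq> 0" if "finite S" for S
      using that
    proof (induction S rule: finite_induct)
      case empty
      have "restr (above 1) z = z"
        using supp by (intro restr_id) (auto simp: supported_def)
      then show ?case using z_ne by (simp add: one_fun_def zero_fun_def)
    next
      case (insert i S)
      define f where "f = (\<lambda>i. if i \<in> S then e i else 1)"
      have f1: "1 \<le> f" using e1 by (auto simp: f_def le_fun_def)
      have fi: "(\<lambda>j. if j \<in> insert i S then e j else 1) = f(i := e i)"
        by (auto simp: f_def)
      have le: "f \<le> f(i := e i)"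
        using e1[of i] insert.hyps by (auto simp: f_def le_fun_def)
      have "f(i := e i) - 1 \<le> e - 1"
        using e1 by (auto simp: f_def le_fun_def int_one_le_iff_zero_less)
      then have J': "f(i := e i) - 1 \<notin> J" using e(2) J_up by blast
      have slab: "{b \<in> above f. lab b i < e i} = above f - above (f(i := e i))"
        using le by (auto simp: above_def le_fun_def linorder_not_le) 
      have ex: "exact_on D (above f - above (f(i := e i)))"
        using exact_slab[OF f1 _ J'] e1[of i] insert.hyps slab by (simp add: f_def)
      interpret complex_extension D "above f" "above f - above (f(i := e i))" "above (f(i := e i))"
        by (rule above_extension[OF le])
      let ?Q = "above f - above (f(i := e i))"
      show ?case
        unfolding fi
      proof
        assume zero: "restr (above (f(i := e i))) z = 0"
        have Q: "supported ?Q (restr (above f) z)"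
          unfolding supported_def
        proof (intro allI impI)
          fix b assume "restr (above f) z b \<noteq> 0"
          then show "b \<in> ?Q"
            using fun_cong[OF zero, of b] by (auto simp: restr_def split: if_splits)
        qed
        then have "bdry D ?Q (restr (above f) z) = 0"
          using bdry_on_subcomplex cycle[OF f1] by metis
        then obtain w where "bdry D ?Q w = restr (above f) z"
          using ex Q unfolding exact_on_def by blast
        then have "restr (above f) z = 0"
          by (intro top_boundary_zero[of ?Q _ w] top) (auto simp: above_def)
        then show False using insert.IH by (simp add: f_def)
      qed
    qed
    from this[of UNIV] show ?thesis by simp
  qed
  have gen: "\<exists>l w. supported (above e) w \<and>
      v = (\<lambda>b. l * restr (above e) z b) + bdry D (above e) w"
    if e: "1 \<le> e" and v: "supported (above e) v" "bdry D (above e) v = 0" for e v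
  proof (cases "e - 1 \<in> J")
    case True
    then obtain w where "supported (above e) w" "bdry D (above e) w = v"
      using exact_above[OF e] v unfolding exact_on_def by blast
    then have "supported (above e) w \<and> v = (\<lambda>b. 0 * restr (above e) z b) + bdry D (above e) w"
      by (auto simp: fun_eq_iff)
    then show ?thesis by blast
  next
    case False
    obtain y where y: "homology_generator D gr (above e) (int CARD('n) - 1) y"
      using generator_above[OF e False] by blast
    then obtain l w where lw: "restr (above e) z = (\<lambda>b. l * y b) + bdry D (above e) w"
      using cycle[OF e] supported_restr unfolding homology_generator_def by blast
    have "bdry D (above e) w = restr (above e) z - (\<lambda>b. l * y b)"
      using lw by simp
    moreover have "gr b = int CARD('n) - 1" if "(restr (above e) z - (\<lambda>b. l * y b)) b \<noteq> 0" for b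
      using that top[of e b] y unfolding homology_generator_def
      by (metis diff_zero minus_apply mult_zero_right)
    ultimately have "restr (above e) z - (\<lambda>b. l * y b) = 0"
      by (intro top_boundary_zero[of "above e" _ w]) (auto simp: above_def)
    then have zl: "restr (above e) z = (\<lambda>b. l * y b)" by simp
    then have l: "l \<noteq> 0" using nonzero[OF e False] by (auto simp: fun_eq_iff)
    obtain m w' where w': "supported (above e) w'" "v = (\<lambda>b. m * y b) + bdry D (above e) w'"
      using y v unfolding homology_generator_def by blast
    then have "v = (\<lambda>b. (m / l) * restr (above e) z b) + bdry D (above e) w'"
      using l by (simp add: zl)
    then show ?thesis using w'(1) by blast
  qed
  show thesis
    using that[OF supp cycle _ gen] zero nonzero by blast
qed

end

section \<open>Monomial ideals and their irreducible decompositions\<close>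

lemma module_mpoly: "module ((*) :: ('n, 'k::field) mpoly \<Rightarrow> ('n, 'k) mpoly \<Rightarrow> ('n, 'k) mpoly)"
  by unfold_locales (simp_all add: algebra_simps)

lemma lookup_mult_single:
  fixes p :: "('n, 'k::field) mpoly"
  shows "Poly_Mapping.lookup (p * Poly_Mapping.single m s) e =
    (if m \<le> e then Poly_Mapping.lookup p (e - m) * s else 0)"
proof -
  have "Poly_Mapping.lookup (p * Poly_Mapping.single m s) e =
      Sum_any (\<lambda>l. Poly_Mapping.lookup p l * s when e = l + m)"
  proof -
    have "(\<Sum>q. (s when m = q) when e = l + q) = (s when e = l + m)" for l
    proof -
      have "(\<Sum>q. (s when m = q) when e = l + q) = (\<Sum>q. (s when e = l + q) when m = q)"
        by (simp add: when_when conj_commute)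
      then show ?thesis by simp
    qed
    then show ?thesis by (simp add: lookup_mult lookup_single mult_when)
  qed
  also have "\<dots> = (if m \<le> e then Poly_Mapping.lookup p (e - m) * s else 0)"
  proof (cases "m \<le> e")
    case True
    then have "e = l + m \<longleftrightarrow> l = e - m" for l
      by (auto simp: fun_eq_iff le_fun_def)
    then show ?thesis using True by simp
  next
    case False
    then have "e \<noteq> l + m" for l by (auto simp: le_fun_def)
    then show ?thesis using False by simp
  qed
  finally show ?thesis .
qed

lemma sum_monomials:
  fixes p :: "('n, 'k::field) mpoly"
  shows "p = (\<Sum>e\<in>Poly_Mapping.keys p. Poly_Mapping.single e (Poly_Mapping.lookup p e))"
proof (rule poly_mapping_eqI)
  fix k
  have "(\<Sum>e\<in>Poly_Mapping.keys p. Poly_Mapping.lookup p e when e = k) =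
      (\<Sum>e\<in>Poly_Mapping.keys p. if e = k then Poly_Mapping.lookup p k else 0)"
    by (rule sum.cong) (auto simp: when_def)
  then show "Poly_Mapping.lookup p k = Poly_Mapping.lookup
      (\<Sum>e\<in>Poly_Mapping.keys p. Poly_Mapping.single e (Poly_Mapping.lookup p e)) k"
    by (simp add: lookup_sum lookup_single in_keys_iff)
qed

lemma in_monomial_span_iff:
  fixes p :: "('n, 'k::field) mpoly"
  shows "p \<in> ideal_span (xpow ` E) \<longleftrightarrow> (\<forall>e\<in>Poly_Mapping.keys p. \<exists>g\<in>E. g \<le> e)"
proof
  let ?S = "{p :: ('n, 'k) mpoly. \<forall>e\<in>Poly_Mapping.keys p. \<exists>g\<in>E. g \<le> e}"
  have "module.subspace (*) ?S"
  proof (rule module.subspaceI[OF module_mpoly])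
    fix x y assume "x \<in> ?S" "y \<in> ?S"
    then show "x + y \<in> ?S" using Poly_Mapping.keys_add[of x y] by blast
  next
    fix c x :: "('n, 'k) mpoly" assume x: "x \<in> ?S"
    show "c * x \<in> ?S"
    proof (rule CollectI, rule ballI)
      fix e assume "e \<in> Poly_Mapping.keys (c * x)"
      then obtain u v where "e = u + v" "v \<in> Poly_Mapping.keys x"
        using Poly_Mapping.keys_mult[of c x] by blast
      moreover from this obtain g where "g \<in> E" "g \<le> v" using x by blast
      ultimately show "\<exists>g\<in>E. g \<le> e"
        by (auto simp: le_fun_def intro!: bexI[of _ g] trans_le_add2)
    qed
  qed auto
  moreover have "xpow ` E \<subseteq> ?S" by auto
  ultimately have "ideal_span (xpow ` E) \<subseteq> ?S"
    by (intro module.span_minimal[OF module_mpoly])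
  then show "p \<in> ideal_span (xpow ` E) \<Longrightarrow> \<forall>e\<in>Poly_Mapping.keys p. \<exists>g\<in>E. g \<le> e" by blast
next
  assume p: "\<forall>e\<in>Poly_Mapping.keys p. \<exists>g\<in>E. g \<le> e"
  have "(\<Sum>e\<in>Poly_Mapping.keys p. Poly_Mapping.single e (Poly_Mapping.lookup p e))
      \<in> ideal_span (xpow ` E)"
  proof (rule module.span_sum[OF module_mpoly])
    fix e assume "e \<in> Poly_Mapping.keys p"
    then obtain g where g: "g \<in> E" "g \<le> e" using p by blast
    then have "e - g + g = e" by (auto simp: fun_eq_iff le_fun_def)
    then have "Poly_Mapping.single e (Poly_Mapping.lookup p e) =
        Poly_Mapping.single (e - g) (Poly_Mapping.lookup p e) * xpow g"
      by (simp add: mult_single)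
    then show "Poly_Mapping.single e (Poly_Mapping.lookup p e) \<in> ideal_span (xpow ` E)"
      using g by (simp only:) (intro module.span_scale[OF module_mpoly] module.span_base[OF module_mpoly] imageI)
  qed
  then show "p \<in> ideal_span (xpow ` E)" using sum_monomials[of p] by simp
qed

lemma monomial_ideal_iff:
  assumes "monomial_ideal I"
  shows "p \<in> I \<longleftrightarrow> (\<forall>e\<in>Poly_Mapping.keys p. xpow e \<in> I)"
  using assms by (auto simp: monomial_ideal_def in_monomial_span_iff)

lemma monomial_ideal_up:
  assumes "monomial_ideal I" "xpow e \<in> I" "e \<le> e'"
  shows "xpow e' \<in> I"
  using assms order_trans[of _ e e'] by (fastforce simp: monomial_ideal_def in_monomial_span_iff)

lemma m_pow_span: "m_pow b = ideal_span (xpow ` {0(i := b i) | i. 1 \<le> b i})"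
  unfolding m_pow_def by (rule arg_cong[of _ _ ideal_span]) auto

lemma in_m_pow_iff:
  "p \<in> m_pow b \<longleftrightarrow> (\<forall>e\<in>Poly_Mapping.keys p. \<exists>i. 1 \<le> b i \<and> b i \<le> e i)"
proof -
  have "0(i := b i) \<le> e \<longleftrightarrow> b i \<le> e i" for i e by (auto simp: le_fun_def)
  then have "(\<exists>g\<in>{0(i := b i) | i. 1 \<le> b i}. g \<le> e) \<longleftrightarrow> (\<exists>i. 1 \<le> b i \<and> b i \<le> e i)" for e
    by (simp add: Bex_def) metis
  then show ?thesis by (simp add: m_pow_span in_monomial_span_iff)
qed

lemma monomial_ideal_m_pow: "monomial_ideal (m_pow b)"
  unfolding monomial_ideal_def m_pow_span by blast

lemma xpow_in_ideal_sum_iff: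
  assumes I: "monomial_ideal I" and J: "monomial_ideal J"
  shows "xpow e \<in> ideal_sum I J \<longleftrightarrow> xpow e \<in> I \<or> xpow e \<in> J"
proof
  assume "xpow e \<in> ideal_sum I J"
  then obtain p q where pq: "xpow e = p + q" "p \<in> I" "q \<in> J"
    by (auto simp: ideal_sum_def)
  have "e \<in> Poly_Mapping.keys (p + q)" by (simp flip: pq(1))
  then have "e \<in> Poly_Mapping.keys p \<or> e \<in> Poly_Mapping.keys q"
    using Poly_Mapping.keys_add[of p q] by blast
  then show "xpow e \<in> I \<or> xpow e \<in> J"
    using pq monomial_ideal_iff[OF I] monomial_ideal_iff[OF J] by blast
next
  have 0: "0 \<in> I" "0 \<in> J"
    using monomial_ideal_iff[OF I, of 0] monomial_ideal_iff[OF J, of 0] by auto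
  assume "xpow e \<in> I \<or> xpow e \<in> J"
  then show "xpow e \<in> ideal_sum I J"
  proof
    assume "xpow e \<in> I"
    then have "\<exists>p q. xpow e = p + q \<and> p \<in> I \<and> q \<in> J"
      using 0 by (intro exI[of _ "xpow e"] exI[of _ 0]) simp
    then show ?thesis by (simp add: ideal_sum_def)
  next
    assume "xpow e \<in> J"
    then have "\<exists>p q. xpow e = p + q \<and> p \<in> I \<and> q \<in> J"
      using 0 by (intro exI[of _ 0] exI[of _ "xpow e"]) simp
    then show ?thesis by (simp add: ideal_sum_def)
  qed
qed

lemma nondecreasing_subsequence:
  fixes g :: "nat \<Rightarrow> nat"
  obtains t :: "nat \<Rightarrow> nat" where "strict_mono t" "mono (\<lambda>n. g (t n))"
proof -
  obtain t :: "nat \<Rightarrow> nat" where t: "strict_mono t" "monoseq (\<lambda>n. g (t n))"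
    using seq_monosub by blast
  show thesis
  proof (cases "mono (\<lambda>n. g (t n))")
    case True
    then show ?thesis using that[of t] t(1) by simp
  next
    case False
    then have dec: "g (t n) \<le> g (t m)" if "m \<le> n" for m n
      using t(2) that by (auto simp: monoseq_def mono_def)
    obtain k where k: "\<And>n. g (t k) \<le> g (t n)"
      using ex_has_least_nat[of "\<lambda>_. True" _ "\<lambda>n. g (t n)"] by auto
    have "g (t (n + k)) = g (t k)" for n
      using dec[of k "n + k"] k[of "n + k"] by auto
    then have "mono (\<lambda>n. g (t (n + k)))" by (simp add: mono_def)
    moreover have "strict_mono (\<lambda>n. t (n + k))"
      using t(1) by (auto simp: strict_mono_def)
    ultimately show ?thesis using that[of "\<lambda>n. t (n + k)"] by simp
  qed
qed

lemma nondecreasing_subsequence_vectors: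
  fixes f :: "nat \<Rightarrow> 'n \<Rightarrow> nat"
  assumes "finite S"
  shows "\<exists>s :: nat \<Rightarrow> nat. strict_mono s \<and> (\<forall>i\<in>S. mono (\<lambda>n. f (s n) i))"
  using assms
proof (induction S rule: finite_induct)
  case empty
  show ?case by (rule exI[of _ "\<lambda>n. n"]) (auto simp: strict_mono_def)
next
  case (insert i S)
  then obtain s :: "nat \<Rightarrow> nat" where s: "strict_mono s" "\<And>j. j \<in> S \<Longrightarrow> mono (\<lambda>n. f (s n) j)" by blast
  obtain t :: "nat \<Rightarrow> nat" where t: "strict_mono t" "mono (\<lambda>n. f (s (t n)) i)"
    using nondecreasing_subsequence[of "\<lambda>n. f (s n) i"] by blast
  have "strict_mono (\<lambda>n. s (t n))" using s(1) t(1) by (simp add: strict_mono_def)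
  moreover have "mono (\<lambda>n. f (s (t n)) j)" if "j \<in> insert i S" for j
  proof (cases "j = i")
    case True
    then show ?thesis using t(2) by simp
  next
    case False
    then show ?thesis
      using that s(2)[of j] monoD[OF strict_mono_mono[OF t(1)]] by (auto simp: mono_def)
  qed
  ultimately show ?case by (intro exI[of _ "\<lambda>n. s (t n)"]) blast
qed

text \<open>
  Dickson's lemma: the minimal elements of \<open>A\<close> form an antichain, and an infinite antichain is
  impossible because every sequence of vectors has a nondecreasing subsequence.
\<close>

lemma dickson_bound:
  fixes A :: "('n::finite \<Rightarrow> nat) set"
  obtains N where "\<And>a. a \<in> A \<Longrightarrow> \<exists>g\<in>A. g \<le> a \<and> g \<le> N"
proof -
  define M where "M = {a \<in> A. \<forall>b\<in>A. b \<le> a \<longrightarrow> b = a}"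
  have fin: "finite M"
  proof (rule ccontr)
    assume "infinite M"
    then obtain f :: "nat \<Rightarrow> 'n \<Rightarrow> nat" where f: "inj f" "range f \<subseteq> M"
      using infinite_countable_subset by blast
    obtain s :: "nat \<Rightarrow> nat" where s: "strict_mono s" "\<And>i. mono (\<lambda>n. f (s n) i)"
      using nondecreasing_subsequence_vectors[of UNIV f] by auto
    have "f (s 0) \<le> f (s 1)"
      using monoD[OF s(2), of 0 1] by (auto simp: le_fun_def)
    then have "f (s 0) = f (s 1)" using f(2) unfolding M_def by blast
    then have "s 0 = s 1" using f(1) by (simp add: inj_def)
    then show False using s(1) by (metis strict_mono_eq zero_neq_one)
  qed
  have below: "\<exists>g\<in>M. g \<le> a" if "a \<in> A" for a
  proof -
    note a = that
    obtain g where g: "g \<in> A" "g \<le> a"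
      and least: "\<And>b. b \<in> A \<Longrightarrow> b \<le> a \<Longrightarrow> sum g UNIV \<le> sum b UNIV"
      using ex_has_least_nat[of "\<lambda>b. b \<in> A \<and> b \<le> a" a "\<lambda>b. sum b UNIV"] a by blast
    have "b = g" if b: "b \<in> A" "b \<le> g" for b
    proof (rule ccontr)
      assume "b \<noteq> g"
      then obtain i where "b i < g i"
        using b(2) by (metis antisym_conv1 ext le_funD nless_le)
      then have "sum b UNIV < sum g UNIV"
        using b(2) by (intro sum_strict_mono_ex1) (auto simp: le_fun_def)
      then show False using least[OF b(1) order_trans[OF b(2) g(2)]] by simp
    qed
    then show ?thesis using g by (auto simp: M_def)
  qed
  define N where "N i = (\<Sum>g\<in>M. g i)" for i
  have "g \<le> N" if "g \<in> M" for g
    using that fin by (auto simp: N_def le_fun_def intro: member_le_sum)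
  then show thesis using that[of N] below by (metis (no_types, lifting) M_def mem_Collect_eq)
qed

text \<open>
  If \<open>N\<close> bounds generators of \<open>I\<close>, then \<open>I\<close> is the intersection of all
  \<open>m_pow b \<supseteq> I\<close> with \<open>b \<le> N\<close>; a subfamily of least cardinality
  with the same intersection is irredundant.
\<close>

lemma exists_irredundant_decomposition:
  fixes I :: "('n::finite, 'k::field) mpoly set"
  assumes I: "monomial_ideal I"
  shows "\<exists>D. irredundant_decomposition D I"
proof -
  obtain N where N: "\<And>e. xpow e \<in> I \<Longrightarrow> \<exists>g. xpow g \<in> I \<and> g \<le> e \<and> g \<le> N"
    using dickson_bound[of "{e. xpow e \<in> I}"] by auto
  define D0 :: "('n, 'k) mpoly set set" where "D0 = m_pow ` {b. b \<le> N \<and> I \<subseteq> m_pow b}"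
  have "finite (PiE UNIV (\<lambda>i. {..N i}))" by (intro finite_PiE) auto
  moreover have "{b. b \<le> N \<and> I \<subseteq> m_pow b} \<subseteq> PiE UNIV (\<lambda>i. {..N i})"
    by (auto simp: le_fun_def)
  ultimately have D0: "finite D0" unfolding D0_def by (meson finite_imageI finite_subset)
  have "\<Inter>D0 = I"
  proof
    show "I \<subseteq> \<Inter>D0" by (auto simp: D0_def)
    show "\<Inter>D0 \<subseteq> I"
    proof
      fix p assume p: "p \<in> \<Inter>D0"
      have "xpow c \<in> I" if c: "c \<in> Poly_Mapping.keys p" for c
      proof (rule ccontr)
        assume c': "xpow c \<notin> I"
        \<comment> \<open>The largest irreducible ideal without the monomial with exponent \<open>c\<close> has exponents
          \<open>c i + 1\<close>. Those exceeding \<open>N i\<close> can be dropped: a generator bounded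
          by \<open>N\<close> that lies outside the smaller ideal still divides that monomial.\<close>
        define b where "b i = (if c i + 1 \<le> N i then c i + 1 else 0)" for i
        have "b \<le> N" by (auto simp: b_def le_fun_def)
        moreover have "I \<subseteq> m_pow b"
          unfolding subset_iff in_m_pow_iff
        proof (intro allI impI ballI)
          fix q e assume "q \<in> I" "e \<in> Poly_Mapping.keys q"
          then obtain g where g: "xpow g \<in> I" "g \<le> e" "g \<le> N"
            using N monomial_ideal_iff[OF I] by blast
          then have "\<not> g \<le> c" using c' monomial_ideal_up[OF I] by blast
          then obtain i where i: "c i < g i" by (auto simp: le_fun_def linorder_not_le)
          then have "1 \<le> b i \<and> b i \<le> e i"
            using le_funD[OF g(2), of i] le_funD[OF g(3), of i] by (auto simp: b_def)
          then show "\<exists>i. 1 \<le> b i \<and> b i \<le> e i" ..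
        qed
        ultimately have "p \<in> m_pow b" using p by (auto simp: D0_def)
        then obtain i where "1 \<le> b i" "b i \<le> c i" using c by (auto simp: in_m_pow_iff)
        then show False by (auto simp: b_def split: if_splits)
      qed
      then show "p \<in> I" using monomial_ideal_iff[OF I] by blast
    qed
  qed
  then have "D0 \<in> {D. D \<subseteq> D0 \<and> \<Inter>D = I}" by blast
  then obtain D where D: "D \<subseteq> D0" "\<Inter>D = I"
    and least: "\<And>D'. D' \<subseteq> D0 \<Longrightarrow> \<Inter>D' = I \<Longrightarrow> card D \<le> card D'"
    using ex_has_least_nat[of "\<lambda>D. D \<subseteq> D0 \<and> \<Inter>D = I" D0 card] by auto
  have finD: "finite D" using D(1) D0 finite_subset by blast
  have "\<Inter>(D - {Q}) \<noteq> I" if "Q \<in> D" for Q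
    using least[of "D - {Q}"] D(1) card_Diff1_less[OF finD that] by auto
  then show ?thesis
    using D finD unfolding irredundant_decomposition_def D0_def by (intro exI[of _ D]) blast
qed

text \<open>
  Irreducibility: the monomials outside \<open>m_pow b\<close> are closed under least common multiples. If
  each member of \<open>D\<close> had a monomial outside \<open>m_pow b\<close>, the least common multiple of
  these would lie in the intersection but not in \<open>m_pow b\<close>.
\<close>

lemma m_pow_above_Inter:
  fixes b :: "'n::finite \<Rightarrow> nat"
  assumes fin: "finite D" and D: "D \<subseteq> range m_pow"
    and le: "\<Inter>D \<subseteq> (m_pow b :: ('n, 'k::field) mpoly set)"
  shows "\<exists>Q\<in>D. Q \<subseteq> m_pow b"
proof (rule ccontr)
  assume none: "\<not> (\<exists>Q\<in>D. Q \<subseteq> m_pow b)"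
  have "\<exists>e. xpow e \<in> Q \<and> xpow e \<notin> (m_pow b :: ('n, 'k) mpoly set)" if "Q \<in> D" for Q
  proof -
    note in_D = that
    have Q: "monomial_ideal Q" using D that monomial_ideal_m_pow by auto
    obtain p where "p \<in> Q" "p \<notin> m_pow b"
      using none in_D by blast
    then show ?thesis
      using monomial_ideal_iff[OF Q] monomial_ideal_iff[OF monomial_ideal_m_pow] by metis
  qed
  then obtain f where f: "\<And>Q. Q \<in> D \<Longrightarrow> xpow (f Q) \<in> Q"
    "\<And>Q. Q \<in> D \<Longrightarrow> xpow (f Q) \<notin> (m_pow b :: ('n, 'k) mpoly set)"
    by metis
  define c where "c i = Max (insert 0 ((\<lambda>Q. f Q i) ` D))" for i
  have le_c: "f Q \<le> c" if "Q \<in> D" for Q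
    using fin that by (auto simp: c_def le_fun_def)
  have "xpow c \<in> Q" if "Q \<in> D" for Q
  proof -
    have "monomial_ideal Q" using D that monomial_ideal_m_pow by auto
    then show ?thesis using monomial_ideal_up f(1) le_c that by blast
  qed
  then have "xpow c \<in> (m_pow b :: ('n, 'k) mpoly set)" using le by blast
  then obtain i where i: "1 \<le> b i" "b i \<le> c i" by (auto simp: in_m_pow_iff)
  have "c i \<in> insert 0 ((\<lambda>Q. f Q i) ` D)"
    unfolding c_def by (rule Max_in) (use fin in auto)
  then obtain Q where "Q \<in> D" "b i \<le> f Q i" using i by auto
  then show False using f(2)[of Q] i by (auto simp: in_m_pow_iff)
qed

lemma irredundant_decomposition_subset:
  fixes I :: "('n::finite, 'k::field) mpoly set"
  assumes D: "irredundant_decomposition D I" and D': "irredundant_decomposition D' I"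
  shows "D \<subseteq> D'"
proof
  fix Q assume Q: "Q \<in> D"
  have above: "\<exists>Q2\<in>E. Q2 \<subseteq> Q1"
    if "irredundant_decomposition E I" "Q1 \<in> D \<union> D'" for E Q1
  proof -
    note Q1 = that(2)
    obtain b where "Q1 = m_pow b"
      using Q1 D D' unfolding irredundant_decomposition_def by (metis UnE rangeE subsetD)
    moreover have "\<Inter>E \<subseteq> Q1"
    proof -
      have "\<Inter>D = I" "\<Inter>D' = I" "\<Inter>E = I"
        using that(1) D D' by (simp_all add: irredundant_decomposition_def)
      then show ?thesis using Q1 by (metis Inter_lower UnE)
    qed
    ultimately show ?thesis
      using m_pow_above_Inter[of E b] that(1) by (simp add: irredundant_decomposition_def)
  qed
  obtain Q' where Q': "Q' \<in> D'" "Q' \<subseteq> Q" using above[OF D'] Q by blast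
  obtain Q'' where Q'': "Q'' \<in> D" "Q'' \<subseteq> Q'" using above[OF D] Q' by blast
  have "Q'' = Q"
  proof (rule ccontr)
    assume "Q'' \<noteq> Q"
    then have "\<Inter>(D - {Q}) = \<Inter>D" using Q'' Q' Q by blast
    then show False using D Q unfolding irredundant_decomposition_def by metis
  qed
  then have "Q' = Q" using Q' Q'' by (simp add: subset_antisym)
  then show "Q \<in> D'" using Q' by simp
qed

lemma irredundant_decomposition_Irr:
  fixes I :: "('n::finite, 'k::field) mpoly set"
  assumes I: "monomial_ideal I"
  shows "irredundant_decomposition (Irr I) I"
proof -
  obtain D where D: "irredundant_decomposition D I"
    using exists_irredundant_decomposition[OF I] ..
  show ?thesis
    unfolding Irr_def
  proof (rule theI[of _ D])
    show "D' = D" if "irredundant_decomposition D' I" for D'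
      using irredundant_decomposition_subset[OF that D] irredundant_decomposition_subset[OF D that]
      by (rule subset_antisym)
  qed (rule D)
qed

lemma alexander_dual_span:
  "alexander_dual a I = ideal_span (xpow ` {dual_exponent a b | b. m_pow b \<in> Irr I})"
  unfolding alexander_dual_def by (rule arg_cong[of _ _ ideal_span]) auto

lemma monomial_ideal_alexander_dual: "monomial_ideal (alexander_dual a I)"
  unfolding monomial_ideal_def alexander_dual_span by blast

text \<open>
  For each irreducible component, \<open>dual_exponent a b \<le> e\<close> says precisely that
  \<open>a - e\<close> is the exponent of a monomial outside \<open>m_pow b\<close>; and a monomial is
  outside some component iff it is outside their intersection \<open>I\<close>.
\<close>

lemma in_alexander_dual_iff:
  fixes I :: "('n::finite, 'k::field) mpoly set"
  assumes I: "monomial_ideal I"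
  shows "xpow e \<in> alexander_dual a I \<longleftrightarrow> xpow (a - e) \<notin> I"
proof -
  have dual: "dual_exponent a b \<le> e \<longleftrightarrow> xpow (a - e) \<notin> (m_pow b :: ('n, 'k) mpoly set)" for b
  proof -
    have "dual_exponent a b i \<le> e i \<longleftrightarrow> \<not> (1 \<le> b i \<and> b i \<le> (a - e) i)" for i
      by (auto simp: dual_exponent_def)
    then show ?thesis by (auto simp: le_fun_def in_m_pow_iff)
  qed
  have Irr: "Irr I \<subseteq> range m_pow" "\<Inter>(Irr I) = I"
    using irredundant_decomposition_Irr[OF I] by (simp_all add: irredundant_decomposition_def)
  have "xpow e \<in> alexander_dual a I \<longleftrightarrow> (\<exists>b. (m_pow b :: ('n, 'k) mpoly set) \<in> Irr I \<and> dual_exponent a b \<le> e)"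
    by (auto simp: alexander_dual_span in_monomial_span_iff)
  also have "\<dots> \<longleftrightarrow> (\<exists>Q\<in>Irr I. xpow (a - e) \<notin> Q)"
  proof
    assume "\<exists>Q\<in>Irr I. xpow (a - e) \<notin> Q"
    then obtain Q where Q: "Q \<in> Irr I" "xpow (a - e) \<notin> Q" ..
    then obtain b where "Q = m_pow b" using Irr(1) by auto
    then show "\<exists>b. (m_pow b :: ('n, 'k) mpoly set) \<in> Irr I \<and> dual_exponent a b \<le> e"
      using Q dual by auto
  qed (use dual in auto)
  also have "\<dots> \<longleftrightarrow> xpow (a - e) \<notin> \<Inter>(Irr I)" by simp
  finally show ?thesis using Irr(2) by simp
qed

section \<open>Strands of complexes with monomial differential\<close>

definition strand :: "('b, 'n, 'k::field) free_complex \<Rightarrow> ('n \<Rightarrow> int) \<Rightarrow> 'b set" where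
  "strand C d = {b \<in> basis C. mdeg C b \<le> d}"

text \<open>
  In each multidegree \<open>d\<close>, a chain has one scalar coefficient for every basis element of degree
  at most \<open>d\<close>.
\<close>

definition component ::
    "('b, 'n, 'k::field) free_complex \<Rightarrow> ('n \<Rightarrow> int) \<Rightarrow> ('b \<Rightarrow> ('n, 'k) mpoly) \<Rightarrow> 'b \<Rightarrow> 'k" where
  "component C d c =
     restr (strand C d) (\<lambda>b. Poly_Mapping.lookup (c b) (\<lambda>i. nat (d i - mdeg C b i)))"

definition from_component ::
    "('b, 'n, 'k::field) free_complex \<Rightarrow> ('n \<Rightarrow> int) \<Rightarrow> ('b \<Rightarrow> 'k) \<Rightarrow> 'b \<Rightarrow> ('n, 'k) mpoly" where
  "from_component C d v =
     restr (strand C d) (\<lambda>b. Poly_Mapping.single (\<lambda>i. nat (d i - mdeg C b i)) (v b))"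

lemma supported_component: "supported (strand C d) (component C d c)"
  by (simp add: component_def supported_restr)

lemma elements_iff: "c \<in> elements C \<longleftrightarrow> supported (basis C) c"
  by (simp add: elements_def supported_def)

lemma component_of_monomial_degree:
  "b \<in> basis C \<Longrightarrow>
    component C (\<lambda>i. mdeg C b i + int (e i)) c b = Poly_Mapping.lookup (c b) e"
  by (auto simp: component_def restr_def strand_def le_fun_def)

lemma component_ext:
  assumes "c \<in> elements C" "c' \<in> elements C" "\<And>d. component C d c = component C d c'"
  shows "c = c'"
proof
  fix b
  show "c b = c' b"
  proof (cases "b \<in> basis C")
    case True
    then show ?thesis
    proof (intro poly_mapping_eqI)
      fix e
      show "Poly_Mapping.lookup (c b) e = Poly_Mapping.lookup (c' b) e"
        using assms(3)[of "\<lambda>i. mdeg C b i + int (e i)"]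
        by (simp flip: component_of_monomial_degree[OF True])
    qed
  next
    case False
    then have "c b = 0" "c' b = 0" using assms(1,2) by (auto simp: elements_def)
    then show ?thesis by simp
  qed
qed

lemma component_zero: "component C d 0 = 0"
  by (auto simp: component_def restr_def fun_eq_iff)

lemma component_nonzeroD: "component C d c b \<noteq> 0 \<Longrightarrow> b \<in> basis C \<and> c b \<noteq> 0"
  by (auto simp: component_def restr_def strand_def split: if_splits)

lemma component_nonzeroE:
  assumes "c \<in> elements C" "c b \<noteq> 0"
  obtains d where "component C d c b \<noteq> 0"
proof -
  obtain e where "Poly_Mapping.lookup (c b) e \<noteq> 0"
    using assms(2) by (auto simp: poly_mapping_eq_iff fun_eq_iff)
  moreover have "b \<in> basis C"
    using assms by (simp add: elements_def)
  ultimately show ?thesis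
    using that[of "\<lambda>i. mdeg C b i + int (e i)"] by (simp add: component_of_monomial_degree)
qed

lemma chains_iff:
  "c \<in> chains C j \<longleftrightarrow>
     c \<in> elements C \<and> (\<forall>d b. component C d c b \<noteq> 0 \<longrightarrow> hdeg C b = j)"
  by (auto simp: chains_def dest: component_nonzeroD elim: component_nonzeroE)

lemma finite_components:
  assumes "finite (basis C)" "c \<in> elements C"
  shows "finite {d. component C d c \<noteq> 0}"
proof (rule finite_subset)
  show "{d. component C d c \<noteq> 0} \<subseteq>
    (\<Union>b\<in>basis C. (\<lambda>e i. mdeg C b i + int (e i)) ` Poly_Mapping.keys (c b))"
  proof
    fix d assume "d \<in> {d. component C d c \<noteq> 0}"
    then obtain b where b: "component C d c b \<noteq> 0" by (auto simp: fun_eq_iff)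
    then have le: "mdeg C b i \<le> d i" for i
      by (auto simp: component_def restr_def strand_def le_fun_def split: if_splits)
    have "(\<lambda>i. nat (d i - mdeg C b i)) \<in> Poly_Mapping.keys (c b)"
      using b by (auto simp: component_def restr_def in_keys_iff split: if_splits)
    moreover have "d = (\<lambda>i. mdeg C b i + int (nat (d i - mdeg C b i)))"
      using le by (auto simp: fun_eq_iff)
    ultimately show "d \<in> (\<Union>b\<in>basis C. (\<lambda>e i. mdeg C b i + int (e i)) ` Poly_Mapping.keys (c b))"
      using component_nonzeroD[OF b] by (intro UN_I[of b] image_eqI) auto
  qed
qed (use assms in auto)

lemma component_from_component:
  assumes "supported (strand C d) v"
  shows "component C d' (from_component C d v) = (if d' = d then v else 0)"
proof
  fix b
  show "component C d' (from_component C d v) b = (if d' = d then v else 0) b"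
  proof (cases "b \<in> strand C d \<and> b \<in> strand C d'")
    case True
    then have "(\<lambda>i. nat (d i - mdeg C b i)) = (\<lambda>i. nat (d' i - mdeg C b i)) \<longleftrightarrow> d' = d"
      by (auto simp: strand_def le_fun_def fun_eq_iff) (metis diff_ge_0_iff_ge eq_nat_nat_iff diff_add_cancel)
    then show ?thesis
      using True by (simp add: component_def from_component_def restr_def lookup_single when_def)
  next
    case False
    then show ?thesis
      using assms by (auto simp: component_def from_component_def restr_def supported_def)
  qed
qed

lemma from_component_in_elements: "from_component C d v \<in> elements C"
  by (auto simp: elements_def from_component_def restr_def strand_def split: if_splits)

lemma exists_with_components:
  assumes "\<And>d. supported (strand C d) (w d)" and fin: "finite {d. w d \<noteq> 0}"
  shows "\<exists>c\<in>elements C. \<forall>d. component C d c = w d"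
proof (intro bexI allI)
  define c where "c = (\<lambda>b. \<Sum>d\<in>{d. w d \<noteq> 0}. from_component C d (w d) b)"
  show "c \<in> elements C"
    unfolding elements_iff supported_def
  proof (intro allI impI, rule ccontr)
    fix b assume "c b \<noteq> 0" "b \<notin> basis C"
    then show False by (simp add: c_def from_component_def restr_def strand_def)
  qed
  fix d
  have "component C d c b = (\<Sum>d'\<in>{d. w d \<noteq> 0}. component C d (from_component C d' (w d')) b)" for b
    by (auto simp: component_def restr_def c_def lookup_sum)
  also have "\<dots> b = (\<Sum>d'\<in>{d. w d \<noteq> 0}. if d' = d then w d b else 0)" for b
    by (rule sum.cong) (auto simp: component_from_component[OF assms(1)])
  also have "\<dots> b = w d b" for b
    using fin by auto
  finally show "component C d c = w d" by blast
qed

text \<open>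
  A homomorphism from the chains to the free module generated in degree \<open>m\<close> that is given by
  monomials with scalar coefficients \<open>t\<close> acts on the component in degree \<open>d\<close> by the
  scalars alone. With \<open>m\<close> the degree of a basis element this describes the differential, with
  \<open>m = 0\<close> an augmentation map to \<open>S\<close>.
\<close>

lemma lookup_monomial_sum:
  fixes C :: "('b, 'n, 'k::field) free_complex"
  assumes fin: "finite (basis C)" and m: "m \<le> d"
    and t: "\<And>b. b \<in> basis C \<Longrightarrow> t b \<noteq> 0 \<Longrightarrow> m \<le> mdeg C b"
  shows "Poly_Mapping.lookup
      (\<Sum>b\<in>basis C. c b * Poly_Mapping.single (\<lambda>i. nat (mdeg C b i - m i)) (t b))
      (\<lambda>i. nat (d i - m i)) = (\<Sum>b\<in>strand C d. component C d c b * t b)"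
proof -
  have "Poly_Mapping.lookup (c b * Poly_Mapping.single (\<lambda>i. nat (mdeg C b i - m i)) (t b))
      (\<lambda>i. nat (d i - m i)) = (if b \<in> strand C d then component C d c b * t b else 0)"
    if b: "b \<in> basis C" for b
  proof (cases "t b = 0")
    case False
    then have mb: "m i \<le> mdeg C b i" for i using t b by (auto simp: le_fun_def)
    have md: "m i \<le> d i" for i using m by (auto simp: le_fun_def)
    have "nat (mdeg C b i - m i) \<le> nat (d i - m i) \<longleftrightarrow> mdeg C b i \<le> d i" for i
      using mb[of i] md[of i] by auto
    then have "(\<lambda>i. nat (mdeg C b i - m i)) \<le> (\<lambda>i. nat (d i - m i)) \<longleftrightarrow> b \<in> strand C d"
      using b by (simp add: strand_def le_fun_def)
    moreover have "(\<lambda>i. nat (d i - m i)) - (\<lambda>i. nat (mdeg C b i - m i)) = (\<lambda>i. nat (d i - mdeg C b i))"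
      if "b \<in> strand C d"
    proof
      fix i
      have "mdeg C b i \<le> d i" using that by (auto simp: strand_def le_fun_def)
      then show "((\<lambda>i. nat (d i - m i)) - (\<lambda>i. nat (mdeg C b i - m i))) i = nat (d i - mdeg C b i)"
        using mb[of i] by simp
    qed
    ultimately show ?thesis
      by (simp add: lookup_mult_single component_def restr_def)
  qed simp
  then have "Poly_Mapping.lookup
      (\<Sum>b\<in>basis C. c b * Poly_Mapping.single (\<lambda>i. nat (mdeg C b i - m i)) (t b))
      (\<lambda>i. nat (d i - m i)) = (\<Sum>b\<in>basis C. if b \<in> strand C d then component C d c b * t b else 0)"
    by (simp add: lookup_sum)
  also have "\<dots> = (\<Sum>b\<in>strand C d. component C d c b * t b)"
    using fin by (intro sum.mono_neutral_cong_right) (auto simp: strand_def)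
  finally show ?thesis .
qed

text \<open>
  A complex whose differential has monomial entries, made homogeneous from a scalar matrix \<open>s\<close>.
  It splits into its strands, on which the differential is given by \<open>s\<close>, and everything about the
  complex can be checked there.
\<close>

locale monomial_complex =
  fixes C :: "('b, 'n, 'k::field) free_complex" and s :: "'b \<Rightarrow> 'b \<Rightarrow> 'k"
  assumes finite_basis: "finite (basis C)"
    and dcoeff: "b \<in> basis C \<Longrightarrow> b' \<in> basis C \<Longrightarrow>
      dcoeff C b b' = Poly_Mapping.single (\<lambda>i. nat (mdeg C b i - mdeg C b' i)) (s b b')"
    and mdeg_face: "b \<in> basis C \<Longrightarrow> b' \<in> basis C \<Longrightarrow> s b b' \<noteq> 0 \<Longrightarrow> mdeg C b' \<le> mdeg C b"
    and hdeg_face: "b \<in> basis C \<Longrightarrow> b' \<in> basis C \<Longrightarrow> s b b' \<noteq> 0 \<Longrightarrow> hdeg C b' = hdeg C b - 1"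
    and square_zero_strand: "square_zero s (strand C d)"
begin

lemma finite_strand: "finite (strand C d)"
  using finite_basis by (simp add: strand_def)

lemma component_bd: "component C d (bd C c) = bdry s (strand C d) (component C d c)"
proof
  fix b'
  show "component C d (bd C c) b' = bdry s (strand C d) (component C d c) b'"
  proof (cases "b' \<in> strand C d")
    case True
    then have b': "b' \<in> basis C" "mdeg C b' \<le> d" by (auto simp: strand_def)
    have "component C d (bd C c) b' = Poly_Mapping.lookup
        (\<Sum>b\<in>basis C. c b * Poly_Mapping.single (\<lambda>i. nat (mdeg C b i - mdeg C b' i)) (s b b'))
        (\<lambda>i. nat (d i - mdeg C b' i))"
      using True b' by (simp add: component_def restr_def bd_def dcoeff)
    also have "\<dots> = (\<Sum>b\<in>strand C d. component C d c b * s b b')"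
      using b' mdeg_face by (intro lookup_monomial_sum finite_basis) auto
    finally show ?thesis using True by (simp add: bdry_def restr_def)
  qed (simp add: component_def bdry_def restr_def)
qed

lemma bd_in_elements: "bd C c \<in> elements C"
  by (auto simp: elements_def bd_def split: if_splits)

lemma truncate_strand_bdry:
  "bdry s (strand C d) (\<lambda>b. if hdeg C b = j + 1 then v b else 0) =
    (\<lambda>b. if hdeg C b = j then bdry s (strand C d) v b else 0)"
  by (rule truncate_bdry) (auto simp: strand_def intro: hdeg_face)

lemma bd_chains: 
  assumes "c \<in> chains C j" 
  shows "bd C c \<in> chains C (j - 1)"
  unfolding chains_iff
proof (intro conjI bd_in_elements allI impI)
  fix d b assume b: "component C d (bd C c) b \<noteq> 0"
  have "component C d c = (\<lambda>b. if hdeg C b = (j - 1) + 1 then component C d c b else 0)"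
    using assms by (auto simp: chains_iff fun_eq_iff)
  then have "bdry s (strand C d) (component C d c) =
      bdry s (strand C d) (\<lambda>b. if hdeg C b = (j - 1) + 1 then component C d c b else 0)"
    by (rule arg_cong)
  also have "\<dots> = (\<lambda>b. if hdeg C b = j - 1 then bdry s (strand C d) (component C d c) b else 0)"
    by (rule truncate_strand_bdry)
  finally show "hdeg C b = j - 1"
    using b by (auto simp: component_bd dest: fun_cong[of _ _ b] split: if_splits)
qed

lemma graded_iff:
  assumes "c \<in> elements C"
  shows "(\<forall>b\<in>basis C. homogeneous (d - mdeg C b) (c b)) \<longleftrightarrow> (\<forall>d'. d' \<noteq> d \<longrightarrow> component C d' c = 0)"
proof (intro iffI allI impI ballI)
  fix d' assume hom: "\<forall>b\<in>basis C. homogeneous (d - mdeg C b) (c b)" and d': "d' \<noteq> d"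
  show "component C d' c = 0"
  proof (rule ccontr)
    assume "component C d' c \<noteq> 0"
    then obtain b where b: "component C d' c b \<noteq> 0" by (auto simp: fun_eq_iff)
    then have "(\<lambda>i. int (nat (d' i - mdeg C b i))) = d - mdeg C b"
    proof -
      have key: "(\<lambda>i. nat (d' i - mdeg C b i)) \<in> Poly_Mapping.keys (c b)"
        using b by (auto simp: component_def restr_def in_keys_iff split: if_splits)
      have "homogeneous (d - mdeg C b) (c b)" using hom component_nonzeroD[OF b] by simp
      from bspec[OF this[unfolded homogeneous_def] key] show ?thesis .
    qed
    moreover have "mdeg C b i \<le> d' i" for i
      using b by (auto simp: component_def restr_def strand_def le_fun_def split: if_splits)
    ultimately have "d' i = d i" for i by (auto simp: fun_eq_iff)
    then show False using d' by auto
  qed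
next
  fix b assume zero: "\<forall>d'. d' \<noteq> d \<longrightarrow> component C d' c = 0" and b: "b \<in> basis C"
  show "homogeneous (d - mdeg C b) (c b)"
    unfolding homogeneous_def
  proof
    fix e assume "e \<in> Poly_Mapping.keys (c b)"
    then have "component C (\<lambda>i. mdeg C b i + int (e i)) c b \<noteq> 0"
      using component_of_monomial_degree[OF b] by (simp add: in_keys_iff)
    then have "(\<lambda>i. mdeg C b i + int (e i)) = d"
      using zero by (metis zero_fun_apply)
    then show "(\<lambda>i. int (e i)) = d - mdeg C b" by auto
  qed
qed

lemma bd_graded_chains:
  assumes "c \<in> graded_chains C j d"
  shows "bd C c \<in> graded_chains C (j - 1) d"
proof -
  have c: "c \<in> chains C j" "c \<in> elements C" "\<And>d'. d' \<noteq> d \<Longrightarrow> component C d' c = 0"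
    using assms graded_iff[of c d] by (auto simp: graded_chains_def chains_def)
  have "component C d' (bd C c) = 0" if "d' \<noteq> d" for d'
    using c(3)[OF that] by (simp add: component_bd bdry_def restr_def zero_fun_def)
  then show ?thesis
    using bd_chains[OF c(1)] graded_iff[OF bd_in_elements] by (simp add: graded_chains_def)
qed

lemma zero_in_elements: "0 \<in> elements C"
  by (simp add: elements_def)

lemma bd_bd: "bd C (bd C c) = 0"
  by (rule component_ext[OF bd_in_elements zero_in_elements])
    (simp add: component_bd component_zero bdry_bdry finite_strand square_zero_strand)

lemma is_complex: "is_complex C"
  unfolding is_complex_def
  using finite_basis bd_chains bd_graded_chains bd_bd by blast

text \<open>
  Primitives in the separate multidegrees assemble to a primitive with polynomial coefficients, as only
  finitely many multidegrees occur in \<open>c\<close>.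
\<close>

lemma boundaryI:
  assumes c: "c \<in> chains C j"
    and ex: "\<And>d. \<exists>w. supported (strand C d) w \<and> bdry s (strand C d) w = component C d c"
  shows "c \<in> bd C ` chains C (j + 1)"
proof -
  have c': "c \<in> elements C" "\<And>d b. component C d c b \<noteq> 0 \<Longrightarrow> hdeg C b = j"
    using c by (auto simp: chains_iff)
  obtain w where w: "\<And>d. supported (strand C d) (w d)"
    "\<And>d. bdry s (strand C d) (w d) = component C d c"
    using ex by metis
  define u where "u d = (if component C d c = 0 then 0 else (\<lambda>b. if hdeg C b = j + 1 then w d b else 0))"
    for d
  have "supported (strand C d) (u d)" for d
    using w(1)[of d] by (auto simp: u_def supported_def)
  moreover have "finite {d. u d \<noteq> 0}"
    by (rule finite_subset[OF _ finite_components[OF finite_basis c'(1)]]) (auto simp: u_def)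
  ultimately obtain y where y: "y \<in> elements C" "\<And>d. component C d y = u d"
    using exists_with_components by metis
  have "y \<in> chains C (j + 1)"
    using y by (auto simp: chains_iff u_def split: if_splits)
  moreover have "bd C y = c"
  proof (rule component_ext[OF bd_in_elements c'(1)])
    fix d
    have "bdry s (strand C d) (u d) = component C d c"
    proof (cases "component C d c = 0")
      case True
      then show ?thesis by (simp add: u_def bdry_def restr_def zero_fun_def)
    next
      case False
      then have "bdry s (strand C d) (u d) =
          (\<lambda>b. if hdeg C b = j then bdry s (strand C d) (w d) b else 0)"
        by (simp add: u_def truncate_strand_bdry)
      also have "\<dots> = component C d c"
        unfolding w(2) using c'(2)[of d] by (auto simp: fun_eq_iff)
      finally show ?thesis .
    qed
    then show "component C d (bd C y) = component C d c"
      by (simp add: component_bd y(2))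
  qed
  ultimately show ?thesis by blast
qed

lemma from_component_in_chains:
  assumes "supported (strand C d) v" "\<And>b. v b \<noteq> 0 \<Longrightarrow> hdeg C b = j"
  shows "from_component C d v \<in> graded_chains C j d"
proof -
  have "from_component C d v \<in> chains C j"
    using assms by (auto simp: chains_iff from_component_in_elements component_from_component split: if_splits)
  then show ?thesis
    using graded_iff[OF from_component_in_elements] assms(1)
    by (auto simp: graded_chains_def component_from_component)
qed

lemma bd_from_component:
  assumes "supported (strand C d) v"
  shows "bd C (from_component C d v) = from_component C d (bdry s (strand C d) v)"
  by (rule component_ext[OF bd_in_elements from_component_in_elements])
    (simp add: component_bd component_from_component assms supported_bdry,
     simp add: bdry_def restr_def zero_fun_def)

end

section \<open>Vertices and labels of regular cell complexes\<close>

lemma topspace_Euclidean_0: "topspace (Euclidean_space 0) = {\<lambda>i. 0}"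
  by (auto simp: topspace_Euclidean_space)

lemma closed_disc_0: "closed_disc 0 = {\<lambda>i. 0}"
  by (auto simp: closed_disc_def topspace_Euclidean_0)

lemma closed_disc_not_open:
  assumes "0 < d"
  shows "\<exists>x. x \<in> closed_disc d \<and> x \<notin> open_disc d"
proof -
  define x :: "nat \<Rightarrow> real" where "x = (\<lambda>i. if i = 0 then 1 else 0)"
  have "(\<Sum>i<d. (x i)\<^sup>2) = (\<Sum>i<d. if i = 0 then 1 else 0)"
    by (rule sum.cong) (auto simp: x_def)
  also have "\<dots> = 1" using assms by simp
  finally have "(\<Sum>i<d. (x i)\<^sup>2) = 1" .
  moreover have "x \<in> topspace (Euclidean_space d)"
    using assms by (auto simp: topspace_Euclidean_space x_def)
  ultimately show ?thesis by (auto simp: closed_disc_def open_disc_def)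
qed

locale regular_cells =
  fixes X :: "('p, 'n, 'k) cell_complex"
  assumes regular: "regular_cell_complex X"
begin

lemma finite_cells: "finite (cells X)"
  and empty_not_cell: "{} \<notin> cells X"
  using regular by (auto simp: regular_cell_complex_def)

lemma cell_subset_space: "F \<in> cells X \<Longrightarrow> F \<subseteq> topspace (cspace X)"
  using regular by (auto simp: regular_cell_complex_def)

lemma cell_subset_closure: "F \<in> cells X \<Longrightarrow> F \<subseteq> cspace X closure_of F"
  by (simp add: cell_subset_space closure_of_subset)

lemma closure_trans:
  "G \<subseteq> cspace X closure_of F \<Longrightarrow> cspace X closure_of G \<subseteq> cspace X closure_of F"
  by (simp add: closure_of_minimal)

lemma characteristic_map:
  assumes "F \<in> cells X"
  obtains f where "f ` closed_disc (cdim X F) = cspace X closure_of F"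
    "f ` open_disc (cdim X F) = F" "inj_on f (closed_disc (cdim X F))"
proof -
  obtain f where f: "homeomorphic_map
      (subtopology (Euclidean_space (cdim X F)) (closed_disc (cdim X F)))
      (subtopology (cspace X) (cspace X closure_of F)) f" "f ` open_disc (cdim X F) = F"
    using assms regular by (auto simp: regular_cell_complex_def)
  have "topspace (subtopology (Euclidean_space (cdim X F)) (closed_disc (cdim X F))) =
      closed_disc (cdim X F)"
    by (auto simp: closed_disc_def)
  moreover have "topspace (subtopology (cspace X) (cspace X closure_of F)) = cspace X closure_of F"
    using closure_of_subset_topspace[of "cspace X" F] by auto
  ultimately show ?thesis
    using f that[of f] homeomorphic_imp_surjective_map[OF f(1)] homeomorphic_imp_injective_map[OF f(1)]
    by simp
qed

lemma closed_face:
  assumes "F \<in> cells X"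
  shows "cspace X closure_of F - F =
    \<Union>{G \<in> cells X. G \<subseteq> cspace X closure_of F \<and> cdim X G < cdim X F}"
  using assms regular by (simp add: regular_cell_complex_def)

lemma vertex_of_dim_zero:
  assumes "F \<in> cells X" "cdim X F = 0"
  obtains v where "F = {v}"
proof -
  obtain f where f: "f ` closed_disc 0 = cspace X closure_of F"
    using characteristic_map[OF assms(1)] assms(2) by metis
  have "F \<subseteq> {f (\<lambda>i. 0)}"
    using f cell_subset_closure[OF assms(1)] by (simp add: closed_disc_0)
  then show ?thesis using that[of "f (\<lambda>i. 0)"] assms(1) empty_not_cell by (metis subset_singletonD)
qed

text \<open>
  A cell of positive dimension has points of the sphere in its closure, and these lie in cells of smaller
  dimension.
\<close>

lemma exists_vertex:
  "F \<in> cells X \<Longrightarrow> \<exists>v. {v} \<in> cells X \<and> v \<in> cspace X closure_of F"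
proof (induction "cdim X F" arbitrary: F rule: less_induct)
  case less
  show ?case
  proof (cases "cdim X F = 0")
    case True
    then obtain v where "F = {v}" using vertex_of_dim_zero less.prems by blast
    then show ?thesis using less.prems cell_subset_closure[OF less.prems] by auto
  next
    case False
    obtain f where f: "f ` closed_disc (cdim X F) = cspace X closure_of F"
      "f ` open_disc (cdim X F) = F" "inj_on f (closed_disc (cdim X F))"
      using characteristic_map[OF less.prems] by blast
    obtain x where x: "x \<in> closed_disc (cdim X F)" "x \<notin> open_disc (cdim X F)"
      using closed_disc_not_open False by blast
    have "open_disc (cdim X F) \<subseteq> closed_disc (cdim X F)"
      by (auto simp: open_disc_def closed_disc_def)
    have "f x \<notin> F"
    proof
      assume "f x \<in> F"
      then obtain y where "y \<in> open_disc (cdim X F)" "f x = f y" using f(2) by auto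
      then show False using inj_onD[OF f(3)] x \<open>open_disc _ \<subseteq> _\<close> by (metis subsetD)
    qed
    then have "f x \<in> cspace X closure_of F - F" using f(1) x(1) by blast
    then obtain G where G: "G \<in> cells X" "G \<subseteq> cspace X closure_of F" "cdim X G < cdim X F"
      unfolding closed_face[OF less.prems] by blast
    obtain v where "{v} \<in> cells X" "v \<in> cspace X closure_of G"
      using less.hyps[OF G(3,1)] by blast
    then show ?thesis using closure_trans[OF G(2)] by blast
  qed
qed

lemma finite_vertex_labels: "finite {vlabel X v i | v. {v} \<in> cells X \<and> P v}"
proof (rule finite_subset)
  show "{vlabel X v i | v. {v} \<in> cells X \<and> P v} \<subseteq> (\<lambda>F. vlabel X (the_elem F) i) ` cells X"
    by force
qed (use finite_cells in simp)

lemma vertex_label_le: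
  assumes "{v} \<in> cells X" "v \<in> cspace X closure_of F"
  shows "vlabel X v \<le> face_label X F"
  unfolding le_fun_def face_label_def using assms
  by (auto intro!: Max_ge finite_vertex_labels)

lemma face_label_mono:
  assumes "G \<in> cells X" "G \<subseteq> cspace X closure_of F"
  shows "face_label X G \<le> face_label X F"
  unfolding le_fun_def face_label_def
proof (intro allI Max_mono finite_vertex_labels)
  fix i
  show "{vlabel X v i |v. {v} \<in> cells X \<and> v \<in> cspace X closure_of G} \<noteq> {}"
    using exists_vertex[OF assms(1)] by blast
  show "{vlabel X v i |v. {v} \<in> cells X \<and> v \<in> cspace X closure_of G}
    \<subseteq> {vlabel X v i |v. {v} \<in> cells X \<and> v \<in> cspace X closure_of F}"
    using closure_trans[OF assms(2)] by blast
qed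

lemma face_label_vertex:
  assumes "{v} \<in> cells X"
  shows "face_label X {v} = vlabel X v"
proof -
  have "Hausdorff_space (cspace X)" using regular by (simp add: regular_cell_complex_def)
  then have "cspace X closure_of {v} = {v}"
    using cell_subset_space[OF assms]
    by (simp add: closure_of_eq closedin_Hausdorff_sing_eq)
  then have "{vlabel X w i |w. {w} \<in> cells X \<and> w \<in> cspace X closure_of {v}} = {vlabel X v i}" for i
    using assms by auto
  then show ?thesis by (simp add: face_label_def fun_eq_iff)
qed

end

section \<open>The augmented complex of a cellular resolution\<close>

lemma monomial_of_homogeneous:
  assumes "homogeneous d p"
  shows "p = Poly_Mapping.single (\<lambda>i. nat (d i)) (Poly_Mapping.lookup p (\<lambda>i. nat (d i)))"
proof (rule poly_mapping_eqI)
  fix e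
  have "e = (\<lambda>i. nat (d i))" if "Poly_Mapping.lookup p e \<noteq> 0"
  proof -
    have "(\<lambda>i. int (e i)) = d" using assms that by (simp add: homogeneous_def in_keys_iff)
    then show ?thesis by (metis nat_int)
  qed
  then show "Poly_Mapping.lookup p e = Poly_Mapping.lookup
      (Poly_Mapping.single (\<lambda>i. nat (d i)) (Poly_Mapping.lookup p (\<lambda>i. nat (d i)))) e"
    by (auto simp: lookup_single when_def)
qed

text \<open>
  A cellular resolution, together with the augmented cell complex: the empty face, of dimension
  \<open>-1\<close>, gets the label \<open>0\<close> and bounds the vertices.
\<close>

locale resolving_cells =
  fixes X :: "('p, 'n::finite, 'k::field) cell_complex" and J :: "('n, 'k) mpoly set"
  assumes labelled: "labelled_regular_cell_complex X"
    and resolution: "cellular_resolution X J"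
begin

sublocale regular_cells X
  using labelled by unfold_locales (simp add: labelled_regular_cell_complex_def)

abbreviation C :: "('p set, 'n, 'k) free_complex" where
  "C \<equiv> cellular_complex X"

definition faces :: "'p set set" where
  "faces = insert {} (cells X)"

definition inc :: "'p set \<Rightarrow> 'p set \<Rightarrow> 'k" where
  "inc F G = (if F = {} then 0 else incidence X F G)"

definition lab :: "'p set \<Rightarrow> 'n \<Rightarrow> int" where
  "lab F = (if F = {} then 0 else face_label X F)"

definition exponents :: "('n \<Rightarrow> int) set" where
  "exponents = {d. 0 \<le> d \<and> xpow (\<lambda>i. nat (d i)) \<in> J}"

lemma incidence_axioms:
  assumes "F \<in> cells X" "G \<in> faces"
  shows "incidence X F G \<noteq> 0 \<longleftrightarrow> is_facet X G F"
    and "face_dim X F = face_dim X G + 2 \<Longrightarrow> (\<Sum>H\<in>cells X. incidence X F H * incidence X H G) = 0"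
  using labelled assms
  by (auto simp: labelled_regular_cell_complex_def incidence_function_def faces_def)

lemma incidence_vertex: "{v} \<in> cells X \<Longrightarrow> incidence X {v} {} = 1"
  using labelled by (simp add: labelled_regular_cell_complex_def incidence_function_def)

lemma inc_nonzero:
  assumes "F \<in> faces" "G \<in> faces" "inc F G \<noteq> 0"
  shows "F \<in> cells X" "is_facet X G F"
  using assms incidence_axioms(1)[of F G] by (auto simp: inc_def faces_def split: if_splits)

lemma vertex_label_nonneg: "{v} \<in> cells X \<Longrightarrow> 0 \<le> vlabel X v"
  using resolution by (simp add: cellular_resolution_def)

lemma xpow_in_J_iff:
  "xpow e \<in> J \<longleftrightarrow> (\<exists>v. {v} \<in> cells X \<and> (\<forall>i. vlabel X v i \<le> int (e i)))"
proof -
  have "J = ideal_span (xpow ` {\<lambda>i. nat (vlabel X v i) | v. {v} \<in> cells X})"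
    using resolution unfolding cellular_resolution_def
    by (auto intro!: arg_cong[of _ _ ideal_span])
  then show ?thesis
    by (auto simp: in_monomial_span_iff le_fun_def nat_le_iff)
qed

lemma exponents_iff:
  "d \<in> exponents \<longleftrightarrow> 0 \<le> d \<and> (\<exists>v. {v} \<in> cells X \<and> vlabel X v \<le> d)"
  by (auto simp: exponents_def xpow_in_J_iff le_fun_def)

lemma lab_nonneg: "F \<in> faces \<Longrightarrow> 0 \<le> lab F"
proof (cases "F = {}")
  case False
  assume "F \<in> faces"
  then obtain v where "{v} \<in> cells X" "v \<in> cspace X closure_of F"
    using exists_vertex False by (auto simp: faces_def)
  then show ?thesis
    using vertex_label_nonneg vertex_label_le order_trans False by (simp add: lab_def) blast
qed (simp add: lab_def)

sublocale labelled_complex faces inc "face_dim X" lab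
proof
  show "finite faces" by (simp add: faces_def finite_cells)
  show "square_zero inc faces"
    unfolding square_zero_def
  proof (intro ballI)
    fix F G assume FG: "F \<in> faces" "G \<in> faces"
    have "(\<Sum>H\<in>faces. inc F H * inc H G) = (\<Sum>H\<in>cells X. inc F H * inc H G)"
      using finite_cells empty_not_cell by (simp add: faces_def inc_def)
    also have "\<dots> = 0"
    proof (cases "F \<in> cells X \<and> face_dim X F = face_dim X G + 2")
      case True
      then have "(\<Sum>H\<in>cells X. inc F H * inc H G) =
          (\<Sum>H\<in>cells X. incidence X F H * incidence X H G)"
        by (intro sum.cong) (use empty_not_cell in \<open>auto simp: inc_def\<close>)
      then show ?thesis using incidence_axioms(2) True FG by simp
    next
      case False
      have "inc F H * inc H G = 0" if H: "H \<in> cells X" for H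
      proof (rule ccontr)
        have "H \<in> faces" using H by (simp add: faces_def)
        moreover assume "inc F H * inc H G \<noteq> 0"
        ultimately have "F \<in> cells X" "is_facet X H F" "is_facet X G H"
          using inc_nonzero FG by auto
        then show False using False by (simp add: is_facet_def)
      qed
      then show ?thesis by (intro sum.neutral ballI)
    qed
    finally show "(\<Sum>H\<in>faces. inc F H * inc H G) = 0" .
  qed
  show "face_dim X G = face_dim X F - 1" if "F \<in> faces" "G \<in> faces" "inc F G \<noteq> 0" for F G
    using inc_nonzero[OF that] by (simp add: is_facet_def)
  show "lab G \<le> lab F" if "F \<in> faces" "G \<in> faces" "inc F G \<noteq> 0" for F G
  proof (cases "G = {}")
    case True
    then show ?thesis using lab_nonneg[OF that(1)] by (simp add: lab_def)
  next
    case False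
    then show ?thesis
      using inc_nonzero[OF that] that(2) empty_not_cell face_label_mono[of G F]
      by (auto simp: lab_def is_facet_def faces_def)
  qed
qed (rule lab_nonneg)

lemma strand_eq: "strand C d = {F \<in> cells X. face_label X F \<le> d}"
  by (simp add: strand_def cellular_complex_def)

sublocale monomial_complex C inc
proof
  show "finite (basis C)" by (simp add: cellular_complex_def finite_cells)
  fix F G assume FG: "F \<in> basis C" "G \<in> basis C"
  then have ne: "F \<noteq> {}" "G \<noteq> {}" "F \<in> faces" "G \<in> faces"
    using empty_not_cell by (auto simp: cellular_complex_def faces_def)
  show "dcoeff C F G = Poly_Mapping.single (\<lambda>i. nat (mdeg C F i - mdeg C G i)) (inc F G)"
    using ne by (simp add: cellular_complex_def inc_def)
  show "mdeg C G \<le> mdeg C F" if "inc F G \<noteq> 0"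
    using lab_face[OF ne(3,4) that] ne by (simp add: lab_def cellular_complex_def)
  show "hdeg C G = hdeg C F - 1" if "inc F G \<noteq> 0"
    using gr_face[OF ne(3,4) that] by (simp add: cellular_complex_def)
next
  fix d
  show "square_zero inc (strand C d)"
  proof (rule square_zero_subset)
    fix F H G assume "F \<in> strand C d" "G \<in> strand C d" "H \<in> faces" "inc F H \<noteq> 0" "inc H G \<noteq> 0"
    moreover from this have "H \<in> cells X" "F \<in> cells X" "H \<noteq> {}" "F \<noteq> {}"
      using inc_nonzero[of H G] empty_not_cell by (auto simp: strand_eq faces_def)
    ultimately show "H \<in> strand C d"
      using lab_face[of F H] by (auto simp: strand_eq lab_def faces_def intro: order_trans)
  qed (auto simp: strand_eq faces_def)
qed

lemma faces_below:
  assumes "0 \<le> d"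
  shows "{F \<in> faces. lab F \<le> d} = insert {} (strand C d)"
  using assms empty_not_cell by (auto simp: strand_eq faces_def lab_def)

lemma augmented_bdry:
  assumes "supported (strand C d) v"
  shows "bdry inc (insert {} (strand C d)) v =
    (\<lambda>F. if F = {} then \<Sum>b\<in>strand C d. v b * inc b {} else bdry inc (strand C d) v F)"
proof -
  have "{} \<notin> strand C d" using empty_not_cell by (simp add: strand_eq)
  then show ?thesis
    using finite_strand by (auto simp: bdry_def restr_def inc_def fun_eq_iff)
qed

lemma face_dim_nonneg: "F \<noteq> {} \<Longrightarrow> 0 \<le> face_dim X F"
  by (simp add: face_dim_def)

lemma strand_boundary:
  assumes y: "y \<in> chains C (j + 1)" and j: "0 \<le> j"
  shows "supported (strand C d) (component C d y)"
    and "bdry inc (insert {} (strand C d)) (component C d y) = component C d (bd C y)"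
proof -
  show supp: "supported (strand C d) (component C d y)" by (rule supported_component)
  have term_zero: "component C d y F * inc F {} = 0" if F: "F \<in> strand C d" for F
  proof (rule ccontr)
    assume "component C d y F * inc F {} \<noteq> 0"
    then have "face_dim X F = j + 1" "inc F {} \<noteq> 0"
      using y by (auto simp: chains_iff cellular_complex_def)
    then show False
      using gr_face[of F "{}"] F j by (auto simp: faces_def strand_eq face_dim_def)
  qed
  have "(\<Sum>F\<in>strand C d. component C d y F * inc F {}) = 0"
    by (intro sum.neutral ballI term_zero)
  moreover have "component C d (bd C y) {} = 0"
    using empty_not_cell by (simp add: component_def restr_def strand_eq)
  ultimately show "bdry inc (insert {} (strand C d)) (component C d y) = component C d (bd C y)"
    unfolding augmented_bdry[OF supp] by (auto simp: component_bd fun_eq_iff)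
qed

lemma free_resolution_C: "free_resolution C J"
  using resolution[unfolded cellular_resolution_def] by (elim conjE)

lemma hdeg_C: "hdeg C = face_dim X"
  by (simp add: cellular_complex_def)

lemma vertex_dim:
  assumes "{v} \<in> cells X"
  shows "face_dim X {v} = 0"
  using incidence_axioms(1)[of "{v}" "{}"] incidence_vertex assms
  by (simp add: faces_def is_facet_def) (simp add: face_dim_def)

lemma exact_positive:
  assumes j: "0 < j" and v: "supported (strand C d) v" "\<And>F. v F \<noteq> 0 \<Longrightarrow> face_dim X F = j"
    and cycle: "bdry inc (insert {} (strand C d)) v = 0"
  shows "\<exists>w. supported (insert {} (strand C d)) w \<and> bdry inc (insert {} (strand C d)) w = v"
proof -
  have zero: "bdry inc (strand C d) v = 0"
  proof
    fix F
    show "bdry inc (strand C d) v F = 0 F"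
      using fun_cong[OF cycle, of F] empty_not_cell unfolding augmented_bdry[OF v(1)]
      by (cases "F = {}") (auto simp: bdry_def restr_def strand_eq)
  qed
  let ?c = "from_component C d v"
  have "?c \<in> chains C j"
    using from_component_in_chains[OF v(1), of j] v(2) by (simp add: graded_chains_def hdeg_C)
  moreover have "bd C ?c = 0"
    by (simp add: bd_from_component v(1) zero) (simp add: from_component_def restr_def zero_fun_def)
  moreover have "{c \<in> chains C j. bd C c = 0} = bd C ` chains C (j + 1)"
    using free_resolution_C j by (simp add: free_resolution_def)
  ultimately have "?c \<in> bd C ` chains C (j + 1)" by auto
  then obtain y where y: "y \<in> chains C (j + 1)" "bd C y = ?c" by auto
  then have "bdry inc (insert {} (strand C d)) (component C d y) = v"
    using strand_boundary(2)[OF y(1)] j by (simp add: component_from_component[OF v(1)])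
  then show ?thesis
    using strand_boundary(1)[OF y(1)] j by (intro exI[of _ "component C d y"]) (auto simp: supported_def)
qed

text \<open>
  The resolution comes with an arbitrary augmentation \<open>p\<close> onto \<open>J\<close>, while the
  augmented cell complex uses the map \<open>eps\<close> that sums the coefficients of the vertices. In
  multidegree \<open>d\<close> the map \<open>p\<close> is a functional \<open>mu\<close>. Boundaries are
  killed by \<open>eps\<close>, so the kernel of \<open>mu\<close> is contained in that of \<open>eps\<close>;
  as \<open>eps\<close> does not vanish on a vertex, the two functionals are proportional and have the same
  kernel.
\<close>

lemma exact_zero:
  assumes d: "d \<in> exponents"
    and v: "supported (strand C d) v" "\<And>F. v F \<noteq> 0 \<Longrightarrow> face_dim X F = 0"
    and cycle: "bdry inc (insert {} (strand C d)) v = 0"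
  shows "\<exists>w. supported (insert {} (strand C d)) w \<and> bdry inc (insert {} (strand C d)) w = v"
proof -
  from free_resolution_C[unfolded free_resolution_def, THEN conjunct2, THEN conjunct2, THEN conjunct2]
  obtain p where p: "\<forall>c\<in>chains C 0. \<forall>c'\<in>chains C 0. p (c + c') = p c + p c'"
    "\<forall>s. \<forall>c\<in>chains C 0. p (\<lambda>b. s * c b) = s * p c"
    "\<forall>d. \<forall>c\<in>graded_chains C 0 d. homogeneous d (p c)"
    "{c \<in> chains C 0. p c = 0} = bd C ` chains C 1"
    by (elim exE conjE) (rule that)
  have p_add: "p (c + c') = p c + p c'" if "c \<in> chains C 0" "c' \<in> chains C 0" for c c'
    using p(1) that by simp
  have p_scale: "p (\<lambda>b. s * c b) = s * p c" if "c \<in> chains C 0" for s c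
    using p(2) that by simp
  have p_hom: "homogeneous d (p c)" if "c \<in> graded_chains C 0 d" for c d
    using p(3) that by simp
  let ?P = "insert {} (strand C d)"
  let ?e = "\<lambda>i. nat (d i)"
  define mu where "mu x = Poly_Mapping.lookup (p (from_component C d x)) ?e" for x
  define eps where "eps x = (\<Sum>b\<in>strand C d. x b * inc b {})" for x :: "'p set \<Rightarrow> 'k"
  have graded: "from_component C d x \<in> graded_chains C 0 d"
    if "supported (strand C d) x" "\<And>F. x F \<noteq> 0 \<Longrightarrow> face_dim X F = 0" for x
    using that by (intro from_component_in_chains) (auto simp: hdeg_C)
  have p_mu: "p (from_component C d x) = Poly_Mapping.single ?e (mu x)"
    if "supported (strand C d) x" "\<And>F. x F \<noteq> 0 \<Longrightarrow> face_dim X F = 0" for x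
    unfolding mu_def by (rule monomial_of_homogeneous[OF p_hom[OF graded[OF that]]])
  have boundary: "\<exists>w. supported ?P w \<and> bdry inc ?P w = x"
    if x: "supported (strand C d) x" "\<And>F. x F \<noteq> 0 \<Longrightarrow> face_dim X F = 0" "mu x = 0" for x
  proof -
    have "from_component C d x \<in> bd C ` chains C 1"
      using p(4) graded[OF x(1,2)] p_mu[OF x(1,2)] x(3) by (auto simp: graded_chains_def)
    then obtain y where y: "y \<in> chains C (0 + 1)" "bd C y = from_component C d x" by auto
    then show ?thesis
      using strand_boundary[OF y(1), of d]
      by (intro exI[of _ "component C d y"]) (auto simp: component_from_component[OF x(1)] supported_def)
  qed
  have eps_mu: "eps x = 0"
    if x: "supported (strand C d) x" "\<And>F. x F \<noteq> 0 \<Longrightarrow> face_dim X F = 0" "mu x = 0" for x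
  proof -
    obtain w where w: "bdry inc ?P w = x" using boundary[OF x] by blast
    have "square_zero inc ?P" "finite ?P"
    proof -
      have "0 \<le> d" using d by (simp add: exponents_def)
      then have P: "?P = {F \<in> faces. lab F \<le> d}" by (rule faces_below[symmetric])
      show "square_zero inc ?P"
        unfolding P by (rule square_zero_subset) (auto intro: order_trans[OF lab_face])
    qed (simp add: finite_strand)
    then have "bdry inc ?P x = 0" using bdry_bdry w by blast
    from fun_cong[OF this, of "{}"] show ?thesis
      unfolding augmented_bdry[OF x(1)] by (simp add: eps_def)
  qed
  obtain u where u: "{u} \<in> cells X" "vlabel X u \<le> d" using d by (auto simp: exponents_iff)
  define z where "z = (\<lambda>F. if F = {u} then 1 else 0 :: 'k)"
  have z: "supported (strand C d) z" "\<And>F. z F \<noteq> 0 \<Longrightarrow> face_dim X F = 0"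
    using u face_label_vertex[OF u(1)] vertex_dim[OF u(1)]
    by (auto simp: supported_def z_def strand_eq split: if_splits)
  have "eps z = (\<Sum>b\<in>strand C d. if b = {u} then 1 else 0)"
    unfolding eps_def by (rule sum.cong) (auto simp: z_def inc_def incidence_vertex[OF u(1)])
  also have "\<dots> = 1"
    using u face_label_vertex[OF u(1)] finite_strand by (simp add: strand_eq)
  finally have eps_z: "eps z = 1" .
  then have mu_z: "mu z \<noteq> 0" using eps_mu[OF z] by auto
  define m where "m = - (mu v / mu z)"
  define x where "x = (\<lambda>F. v F + m * z F)"
  have x: "supported (strand C d) x" "\<And>F. x F \<noteq> 0 \<Longrightarrow> face_dim X F = 0"
    using v z unfolding supported_def x_def by (metis add_0 mult_zero_right)+
  have "from_component C d x =
      from_component C d v + (\<lambda>F. Poly_Mapping.single 0 m * from_component C d z F)"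
    by (auto simp: from_component_def restr_def x_def fun_eq_iff single_add mult_single)
  moreover have chain: "from_component C d v \<in> chains C 0" "from_component C d z \<in> chains C 0"
    using graded[OF v(1,2)] graded[OF z] by (auto simp: graded_chains_def)
  moreover have "(\<lambda>F. Poly_Mapping.single 0 m * from_component C d z F) \<in> chains C 0"
  proof -
    have "from_component C d z F \<noteq> 0" if "Poly_Mapping.single 0 m * from_component C d z F \<noteq> 0" for F
      using that by (metis mult_zero_right)
    then show ?thesis using chain(2) unfolding chains_def elements_def by blast
  qed
  ultimately have "p (from_component C d x) =
      Poly_Mapping.single ?e (mu v) + Poly_Mapping.single 0 m * Poly_Mapping.single ?e (mu z)"
    using p_add p_scale p_mu[OF v(1,2)] p_mu[OF z] by simp
  also have "\<dots> = Poly_Mapping.single ?e (mu v + m * mu z)"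
    by (simp add: mult_single single_add)
  finally have "mu x = mu v + m * mu z" by (simp add: mu_def)
  then have "mu x = 0" using mu_z by (simp add: m_def)
  then have "eps x = 0" using eps_mu x by blast
  moreover have "eps x = eps v + m * eps z"
    by (simp add: eps_def x_def distrib_right sum.distrib sum_distrib_left mult.assoc)
  moreover have "eps v = 0"
    using fun_cong[OF cycle, of "{}"] unfolding augmented_bdry[OF v(1)] by (simp add: eps_def)
  ultimately have "m = 0" using eps_z by simp
  then have "mu v = 0" using mu_z by (simp add: m_def)
  then show ?thesis using boundary[OF v(1,2)] by blast
qed

lemma exact_faces_below:
  assumes d: "d \<in> exponents"
  shows "exact_on inc {F \<in> faces. lab F \<le> d}"
proof (rule exact_on_gradedI)
  fix j v
  have d0: "0 \<le> d" using d by (simp add: exponents_def)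
  let ?P = "insert {} (strand C d)"
  assume "supported {F \<in> faces. lab F \<le> d} v" "bdry inc {F \<in> faces. lab F \<le> d} v = 0"
    and gr: "\<And>F. v F \<noteq> 0 \<Longrightarrow> face_dim X F = j"
  then have v: "supported ?P v" "bdry inc ?P v = 0"
    unfolding faces_below[OF d0] by simp_all
  have "\<exists>w. supported ?P w \<and> bdry inc ?P w = v"
  proof (cases "0 \<le> j")
    case True
    then have "supported (strand C d) v"
      using v(1) gr by (force simp: supported_def face_dim_def)
    then show ?thesis
      using exact_positive[of j d v] exact_zero[OF d, of v] v(2) gr True by (cases "j = 0") auto
  next
    case False
    then have v0: "v F = 0" if "F \<noteq> {}" for F
      using gr[of F] face_dim_nonneg[OF that] by auto
    obtain u where u: "{u} \<in> cells X" "vlabel X u \<le> d" using d by (auto simp: exponents_iff)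
    then have u': "{u} \<in> strand C d" "{u} \<in> faces"
      by (auto simp: strand_eq face_label_vertex faces_def)
    define w where "w = (\<lambda>F. if F = {u} then v {} else 0)"
    have supp: "supported (strand C d) w" using u' by (auto simp: supported_def w_def)
    have "bdry inc ?P w F = v F" for F
    proof (cases "F = {}")
      case True
      have "(\<Sum>b\<in>strand C d. w b * inc b {}) = (\<Sum>b\<in>strand C d. if b = {u} then v {} else 0)"
        by (rule sum.cong) (auto simp: w_def inc_def incidence_vertex[OF u(1)])
      then show ?thesis
        using True u'(1) finite_strand unfolding augmented_bdry[OF supp] by simp
    next
      case False
      have "w b * inc b F = 0" if "F \<in> strand C d" for b
        using gr_face[of "{u}" F] u'(2) that vertex_dim[OF u(1)] face_dim_nonneg[OF False]
        by (auto simp: w_def strand_eq faces_def)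
      then have "(\<Sum>b\<in>strand C d. w b * inc b F) = 0" if "F \<in> strand C d"
        using that by (intro sum.neutral ballI)
      then show ?thesis
        using False v0 unfolding augmented_bdry[OF supp] by (auto simp: bdry_def restr_def)
    qed
    then show ?thesis using supp by (intro exI[of _ w]) (auto simp: supported_def)
  qed
  then show "\<exists>w. supported {F \<in> faces. lab F \<le> d} w \<and> bdry inc {F \<in> faces. lab F \<le> d} w = v"
    unfolding faces_below[OF d0] .
qed auto

lemma bare_faces_below:
  assumes "0 \<le> d" "d \<notin> exponents"
  shows "{F \<in> faces. lab F \<le> d} = {{}}"
proof -
  have "strand C d = {}"
  proof (rule ccontr)
    assume "strand C d \<noteq> {}"
    then obtain F where F: "F \<in> cells X" "face_label X F \<le> d" by (auto simp: strand_eq)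
    then obtain v where "{v} \<in> cells X" "v \<in> cspace X closure_of F"
      using exists_vertex by blast
    then have "vlabel X v \<le> d" using vertex_label_le F(2) order_trans by blast
    then show False using assms \<open>{v} \<in> cells X\<close> by (auto simp: exponents_iff)
  qed
  then show ?thesis using faces_below[OF assms(1)] by simp
qed

end

section \<open>The dual resolution\<close>

lemma square_zero_transpose: "square_zero D P \<Longrightarrow> square_zero (\<lambda>b b'. D b' b) P"
  by (simp add: square_zero_def mult.commute)

text \<open>
  \<open>I + m_pow (a + 1)\<close> is the artinian ideal that agrees with \<open>I\<close> on the
  monomials with exponents at most \<open>a\<close>.
\<close>

locale artinian_closure_resolution =
  fixes I :: "('n::finite, 'k::field) mpoly set" and a :: "'n \<Rightarrow> nat"
    and X :: "('p, 'n, 'k) cell_complex"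
  assumes I: "monomial_ideal I" and proper: "I \<noteq> UNIV"
    and labelled_X: "labelled_regular_cell_complex X"
    and resolution_X: "cellular_resolution X (ideal_sum I (m_pow (a + 1)))"
    and length_X: "complex_length (cellular_complex X) = int CARD('n) - 1"
begin

sublocale resolving_cells X "ideal_sum I (m_pow (a + 1))"
  by unfold_locales (rule labelled_X resolution_X)+

lemma xpow_in_sum_iff:
  "xpow e \<in> ideal_sum I (m_pow (a + 1)) \<longleftrightarrow> xpow e \<in> I \<or> (\<exists>i. a i < e i)"
  unfolding xpow_in_ideal_sum_iff[OF I monomial_ideal_m_pow] by (auto simp: in_m_pow_iff Suc_le_eq)

lemma one_notin_I: "xpow 0 \<notin> I"
proof
  assume "xpow 0 \<in> I"
  then have "xpow e \<in> I" for e
    by (rule monomial_ideal_up[OF I]) (simp add: le_fun_def)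
  then have "I = UNIV" using monomial_ideal_iff[OF I] by blast
  then show False using proper by simp
qed

sublocale artinian_complex faces inc "face_dim X" lab "{}" exponents "\<lambda>i. int (a i)"
proof
  show "{} \<in> faces" "lab {} = 0" "face_dim X {} = -1"
    by (simp_all add: faces_def lab_def face_dim_def)
  show "exact_on inc {b \<in> faces. lab b \<le> d}" if "d \<in> exponents" for d
    using that by (rule exact_faces_below)
  show "{b \<in> faces. lab b \<le> d} = {{}}" if "0 \<le> d" "d \<notin> exponents" for d
    using that by (rule bare_faces_below)
  show "d' \<in> exponents" if "d \<in> exponents" "d \<le> d'" for d d'
    using that by (auto simp: exponents_iff intro: order_trans)
  show "d \<in> exponents" if "0 \<le> d" "int (a i) < d i" for d i
    using that by (auto simp: exponents_def xpow_in_sum_iff intro!: exI[of _ i])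
  show "0 \<notin> exponents"
    using one_notin_I by (auto simp: exponents_def xpow_in_sum_iff zero_fun_def)
  show "face_dim X F \<le> int CARD('n) - 1" if "F \<in> faces" for F
  proof (cases "F = {}")
    case True
    then show ?thesis by (simp add: face_dim_def)
  next
    case False
    then have "face_dim X F \<in> hdeg C ` basis C"
      using that by (auto simp: faces_def cellular_complex_def)
    then show ?thesis
      using length_X finite_basis unfolding complex_length_def by (metis Max_ge finite_imageI)
  qed
qed

definition dual :: "('p set, 'n, 'k) free_complex" where
  "dual = shift_complex (- (\<lambda>i. int (a i)) - 1) (1 - int CARD('n))
    (relative_cocellular_complex X (neg_unbounded X))"

text \<open>
  The dual basis element of \<open>F\<close> has degree \<open>a + 1 - a\<^sub>F\<close>, so the strand of
  the dual complex in degree \<open>d\<close> is spanned by the cells \<open>F\<close> with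
  \<open>a\<^sub>F \<succeq> 1\<close> and \<open>a\<^sub>F \<succeq> a + 1 - d\<close>.
\<close>

definition corner :: "('n \<Rightarrow> int) \<Rightarrow> 'n \<Rightarrow> int" where
  "corner d i = max 1 (int (a i) + 1 - d i)"

lemma corner_ge_1: "1 \<le> corner d"
  by (simp add: corner_def le_fun_def)

lemma dual_simps:
  "basis dual = {F \<in> cells X. 1 \<le> face_label X F}"
  "mdeg dual F i = int (a i) + 1 - face_label X F i"
  "hdeg dual F = int CARD('n) - 1 - face_dim X F"
  "dcoeff dual F G = dcoeff C G F"
  by (auto simp: dual_def shift_complex_def relative_cocellular_complex_def dual_complex_def
      quotient_complex_def cellular_complex_def neg_unbounded_def)

lemma above_cells:
  assumes "1 \<le> e"
  shows "above e = {F \<in> cells X. e \<le> face_label X F}"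
proof -
  have "\<not> e \<le> 0"
    using order_trans[OF assms, of 0] by (auto simp: le_fun_def)
  then show ?thesis
    unfolding above_def using empty_not_cell by (auto simp: faces_def lab_def)
qed

lemma strand_dual: "strand dual d = above (corner d)"
proof -
  have "corner d \<le> l \<longleftrightarrow> 1 \<le> l \<and> (\<forall>i. int (a i) + 1 - l i \<le> d i)" for l
    by (simp add: corner_def le_fun_def) (smt (verit))
  then show ?thesis
    unfolding above_cells[OF corner_ge_1]
    by (auto simp: strand_def dual_simps le_fun_def)
qed

sublocale dual: monomial_complex dual "\<lambda>F G. inc G F"
proof
  show "finite (basis dual)" using finite_cells by (simp add: dual_simps)
  fix F G assume FG: "F \<in> basis dual" "G \<in> basis dual"
  then have ne: "F \<noteq> {}" "G \<noteq> {}" "F \<in> faces" "G \<in> faces"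
    using empty_not_cell by (auto simp: dual_simps faces_def)
  show "dcoeff dual F G = Poly_Mapping.single (\<lambda>i. nat (mdeg dual F i - mdeg dual G i)) (inc G F)"
    using ne by (simp add: dual_simps cellular_complex_def inc_def)
  show "mdeg dual G \<le> mdeg dual F" if "inc G F \<noteq> 0"
    using lab_face[OF ne(4,3) that] ne by (simp add: lab_def dual_simps le_fun_def)
  show "hdeg dual G = hdeg dual F - 1" if "inc G F \<noteq> 0"
    using gr_face[OF ne(4,3) that] by (simp add: dual_simps)
next
  fix d
  have "square_zero inc (above (corner d))"
    using above_extension[of "corner d" "corner d"] by (simp add: complex_extension_def)
  then show "square_zero (\<lambda>F G. inc G F) (strand dual d)"
    unfolding strand_dual by (rule square_zero_transpose)
qed

text \<open>
  Among the nonnegative multidegrees, this identifies those in which the dual complex has homology. In degree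
  \<open>e \<succeq> 0\<close> the corner is \<open>1\<close> more than the truncated difference
  \<open>a - e\<close>, which never exceeds \<open>a\<close>; hence membership in the artinian ideal is
  membership in \<open>I\<close>.
\<close>

lemma corner_exponents_iff:
  "corner (\<lambda>i. int (e i)) - 1 \<in> exponents \<longleftrightarrow> xpow e \<notin> alexander_dual a I"
proof -
  have eq: "(\<lambda>i. nat ((corner (\<lambda>i. int (e i)) - 1) i)) = a - e"
    by (auto simp: corner_def fun_eq_iff)
  have "0 \<le> corner (\<lambda>i. int (e i)) - 1"
    by (simp add: corner_def le_fun_def less_max_iff_disj)
  moreover have "xpow (a - e) \<in> ideal_sum I (m_pow (a + 1)) \<longleftrightarrow> xpow (a - e) \<in> I"
  proof -
    have "\<not> a i < (a - e) i" for i by (simp add: not_less)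
    then show ?thesis unfolding xpow_in_sum_iff by blast
  qed
  ultimately have "corner (\<lambda>i. int (e i)) - 1 \<in> exponents \<longleftrightarrow> xpow (a - e) \<in> I"
    unfolding exponents_def mem_Collect_eq eq by blast
  then show ?thesis by (simp add: in_alexander_dual_iff[OF I])
qed

lemma corner_exponents_negative:
  assumes "d i < 0"
  shows "corner d - 1 \<in> exponents"
  using corner_ge_1[of d] assms
  by (intro J_large[of _ i]) (auto simp: corner_def)

text \<open>
  The augmentation onto the Alexander dual is pairing with the top cycle \<open>z\<close>. In each
  multidegree, cocycles that pair to zero with \<open>z\<close> vanish on all cycles and hence are
  coboundaries, and the pairing is nonzero precisely when \<open>z\<close> survives at the corner, that is, in
  the degrees of the Alexander dual.
\<close>

lemma free_resolution_dual: "free_resolution dual (alexander_dual a I)"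
proof -
  obtain z where z_supp: "\<And>F. z F \<noteq> 0 \<Longrightarrow> F \<in> above 1 \<and> face_dim X F = int CARD('n) - 1"
    and z_cycle: "\<And>e. 1 \<le> e \<Longrightarrow> bdry inc (above e) (restr (above e) z) = 0"
    and z_zero: "\<And>e. 1 \<le> e \<Longrightarrow> restr (above e) z = 0 \<longleftrightarrow> e - 1 \<in> exponents"
    and z_gen: "\<And>e v. 1 \<le> e \<Longrightarrow> supported (above e) v \<Longrightarrow> bdry inc (above e) v = 0 \<Longrightarrow>
      \<exists>l w. supported (above e) w \<and> v = (\<lambda>F. l * restr (above e) z F) + bdry inc (above e) w"
    by (rule top_cycle) (rule that; blast)
  have z_vanish: "z F = 0" if "restr (above e) z = 0" "F \<in> above e" for e F
    using fun_cong[OF that(1), of F] that(2) by (simp add: restr_def)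
  \<comment> \<open>No cell in the support of \<open>z\<close> has a label exceeding \<open>a + 1\<close>, since
    \<open>z\<close> restricts to zero at a corner with a coordinate above \<open>a i + 1\<close>.
    Hence the entries of the augmentation are monomials of \<open>S\<close>.\<close>
  have z_le: "0 \<le> mdeg dual F" if "z F \<noteq> 0" for F
  proof (rule ccontr)
    assume "\<not> 0 \<le> mdeg dual F"
    then obtain i where i: "int (a i) + 1 < face_label X F i"
      by (auto simp: le_fun_def dual_simps not_le)
    define e :: "'n \<Rightarrow> int" where "e = 1(i := int (a i) + 2)"
    have e: "1 \<le> e" by (auto simp: e_def le_fun_def)
    have "F \<in> above e"
      using z_supp[OF that] i e unfolding above_cells[OF e] above_cells[OF order_refl]
      by (auto simp: e_def le_fun_def)
    moreover have "e - 1 \<in> exponents"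
      using e by (intro J_large[of _ i]) (auto simp: e_def)
    ultimately show False using z_zero[OF e] z_vanish that by blast
  qed
  define pair where "pair d c = (\<Sum>F\<in>above (corner d). component dual d c F * z F)" for d c
  define p where "p c = (\<Sum>F\<in>basis dual. c F * Poly_Mapping.single (\<lambda>i. nat (mdeg dual F i)) (z F))" for c
  have lookup_p: "Poly_Mapping.lookup (p c) e = pair (\<lambda>i. int (e i)) c" for c e
    using lookup_monomial_sum[OF dual.finite_basis, of 0 "\<lambda>i. int (e i)" z c] z_le
    by (simp add: p_def pair_def strand_dual le_fun_def)
  have pair_negative: "pair d c = 0" if "\<not> 0 \<le> d" for d c
  proof -
    obtain i where "d i < 0" using \<open>\<not> 0 \<le> d\<close> by (auto simp: le_fun_def not_le)
    then have "restr (above (corner d)) z = 0"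
      using z_zero corner_ge_1 corner_exponents_negative by blast
    then show ?thesis unfolding pair_def by (simp add: z_vanish)
  qed
  have p_zero: "p c = 0 \<longleftrightarrow> (\<forall>d. pair d c = 0)" for c
  proof
    assume p: "p c = 0"
    show "\<forall>d. pair d c = 0"
    proof
      fix d
      show "pair d c = 0"
      proof (cases "0 \<le> d")
        case True
        then have "d = (\<lambda>i. int (nat (d i)))" by (auto simp: le_fun_def)
        then show ?thesis using lookup_p[of c "\<lambda>i. nat (d i)"] p by simp
      qed (rule pair_negative)
    qed
  qed (auto intro!: poly_mapping_eqI simp: lookup_p)
  have boundary: "c \<in> bd dual ` chains dual (j + 1)"
    if c: "c \<in> chains dual j" "bd dual c = 0" "\<And>d. pair d c = 0" for c j
  proof (rule dual.boundaryI[OF c(1)])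
    fix d
    let ?P = "above (corner d)"
    define f where "f = component dual d c"
    have "component dual d (bd dual c) = 0"
      unfolding c(2) by (rule component_zero)
    then have "bdry (\<lambda>F G. inc G F) ?P f = 0"
      by (simp add: dual.component_bd strand_dual f_def)
    then have f_cocycle: "(\<Sum>G\<in>?P. f G * inc F G) = 0" if "F \<in> ?P" for F
      using that by (auto simp: bdry_def restr_def dest: fun_cong[of _ _ F])
    have finite_P: "finite ?P" using dual.finite_strand[of d] by (simp add: strand_dual)
    have "\<exists>g. \<forall>F\<in>?P. f F = (\<Sum>G\<in>?P. g G * inc F G)"
    proof (rule annihilator_of_common_kernel[OF finite_P finite_P])
      fix v assume v: "\<And>G. G \<in> ?P \<Longrightarrow> (\<Sum>F\<in>?P. v F * inc F G) = 0"
      have "bdry inc ?P (restr ?P v) = 0"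
        using v by (auto simp: bdry_def restr_def fun_eq_iff)
      then obtain l w where w: "supported ?P w"
        "restr ?P v = (\<lambda>F. l * restr ?P z F) + bdry inc ?P w"
        using z_gen[OF corner_ge_1 supported_restr] by blast
      have "v F = l * z F + (\<Sum>G\<in>?P. w G * inc G F)" if "F \<in> ?P" for F
        using fun_cong[OF w(2), of F] that by (simp add: restr_def bdry_def)
      then have "(\<Sum>F\<in>?P. v F * f F) =
          (\<Sum>F\<in>?P. l * (f F * z F) + (\<Sum>G\<in>?P. w G * (f F * inc G F)))"
        by (intro sum.cong refl) (simp add: algebra_simps sum_distrib_left)
      also have "\<dots> = l * (\<Sum>F\<in>?P. f F * z F) + (\<Sum>G\<in>?P. w G * (\<Sum>F\<in>?P. f F * inc G F))"
        by (simp add: sum.distrib sum_distrib_left) (rule sum.swap)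
      also have "\<dots> = 0"
        using c(3)[of d] f_cocycle by (simp add: pair_def f_def)
      finally show "(\<Sum>F\<in>?P. v F * f F) = 0" .
    qed
    then obtain g where g: "\<And>F. F \<in> ?P \<Longrightarrow> f F = (\<Sum>G\<in>?P. g G * inc F G)" by blast
    have "bdry (\<lambda>F G. inc G F) ?P (restr ?P g) = f"
    proof
      fix F
      show "bdry (\<lambda>F G. inc G F) ?P (restr ?P g) F = f F"
        using g[of F] supported_component[of dual d c]
        by (auto simp: bdry_def restr_def f_def strand_dual supported_def)
    qed
    then show "\<exists>w. supported (strand dual d) w \<and>
        bdry (\<lambda>F G. inc G F) (strand dual d) w = component dual d c"
      unfolding strand_dual f_def[symmetric] using supported_restr by blast
  qed
  have pair_bd: "pair d (bd dual y) = 0" for d y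
  proof -
    let ?P = "above (corner d)"
    have cycle: "(\<Sum>F\<in>?P. z F * inc F G) = 0" if "G \<in> ?P" for G
    proof -
      have "(\<Sum>F\<in>?P. restr ?P z F * inc F G) = 0"
        using fun_cong[OF z_cycle[OF corner_ge_1], of d G] that by (simp add: bdry_def restr_def)
      then show ?thesis by (simp add: restr_def)
    qed
    have "pair d (bd dual y) = (\<Sum>F\<in>?P. (\<Sum>G\<in>?P. component dual d y G * inc F G) * z F)"
      unfolding pair_def dual.component_bd strand_dual
      by (intro sum.cong refl) (simp add: bdry_def restr_def)
    also have "\<dots> = (\<Sum>G\<in>?P. component dual d y G * (\<Sum>F\<in>?P. z F * inc F G))"
      by (simp add: sum_distrib_left sum_distrib_right mult_ac) (rule sum.swap)
    also have "\<dots> = 0" using cycle by simp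
    finally show ?thesis .
  qed
  \<comment> \<open>\<open>z\<close> lives on cells of dimension \<open>CARD('n) - 1\<close>, whose dual basis
    elements have degree \<open>0\<close>.\<close>
  have pair_degree: "pair d c = 0" if "c \<in> chains dual j" "j \<noteq> 0" for c d j
    unfolding pair_def
  proof (intro sum.neutral ballI, rule ccontr)
    fix F assume "component dual d c F * z F \<noteq> 0"
    then have "hdeg dual F = j" "face_dim X F = int CARD('n) - 1"
      using that(1) z_supp by (auto simp: chains_iff)
    then show False using that(2) by (simp add: dual_simps)
  qed
  have hdeg_nonneg: "0 \<le> hdeg dual F" if "F \<in> basis dual" for F
    using gr_le[of F] that by (auto simp: dual_simps faces_def)
  have bd_chain_zero: "bd dual c = 0" if "c \<in> chains dual 0" for c
  proof
    fix F
    show "bd dual c F = 0 F"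
      using dual.bd_chains[OF that] hdeg_nonneg[of F]
      by (cases "bd dual c F = 0") (auto simp: chains_def elements_def)
  qed
  have exact: "{c \<in> chains dual j. bd dual c = 0} = bd dual ` chains dual (j + 1)" if "0 < j" for j
  proof
    show "{c \<in> chains dual j. bd dual c = 0} \<subseteq> bd dual ` chains dual (j + 1)"
      using boundary pair_degree that by auto
    show "bd dual ` chains dual (j + 1) \<subseteq> {c \<in> chains dual j. bd dual c = 0}"
      using dual.bd_chains[of _ "j + 1"] dual.bd_bd by auto
  qed
  have kernel: "{c \<in> chains dual 0. p c = 0} = bd dual ` chains dual 1"
  proof
    show "{c \<in> chains dual 0. p c = 0} \<subseteq> bd dual ` chains dual 1"
      using boundary[of _ 0] bd_chain_zero p_zero by auto
    show "bd dual ` chains dual 1 \<subseteq> {c \<in> chains dual 0. p c = 0}"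
      using dual.bd_chains[of _ 1] pair_bd p_zero by auto
  qed
  have p_add: "p (c + c') = p c + p c'" for c c'
    by (simp add: p_def distrib_right sum.distrib)
  have p_scale: "p (\<lambda>b. s * c b) = s * p c" for s c
    by (simp add: p_def sum_distrib_left mult.assoc)
  have p_homogeneous: "homogeneous d (p c)" if "c \<in> graded_chains dual 0 d" for d c
    unfolding homogeneous_def
  proof
    fix e assume "e \<in> Poly_Mapping.keys (p c)"
    then have "pair (\<lambda>i. int (e i)) c \<noteq> 0" by (simp add: in_keys_iff lookup_p)
    then have "component dual (\<lambda>i. int (e i)) c \<noteq> 0" by (auto simp: pair_def)
    then show "(\<lambda>i. int (e i)) = d"
      using that dual.graded_iff[of c d] by (auto simp: graded_chains_def chains_def)
  qed
  have "p ` chains dual 0 \<subseteq> alexander_dual a I"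
  proof
    fix q assume "q \<in> p ` chains dual 0"
    then obtain c where q: "q = p c" by blast
    show "q \<in> alexander_dual a I"
      unfolding monomial_ideal_iff[OF monomial_ideal_alexander_dual, of q]
    proof
      fix e assume "e \<in> Poly_Mapping.keys q"
      then have "pair (\<lambda>i. int (e i)) c \<noteq> 0" by (simp add: in_keys_iff lookup_p q)
      then have "restr (above (corner (\<lambda>i. int (e i)))) z \<noteq> 0"
        using z_vanish unfolding pair_def by (metis (no_types, lifting) mult_zero_right sum.neutral)
      then show "xpow e \<in> alexander_dual a I"
        using z_zero[OF corner_ge_1] corner_exponents_iff by blast
    qed
  qed
  moreover have "alexander_dual a I \<subseteq> p ` chains dual 0"
    unfolding alexander_dual_span
  proof (rule module.span_minimal[OF module_mpoly])
    show "module.subspace (*) (p ` chains dual 0)"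
    proof (rule module.subspaceI[OF module_mpoly])
      have "(0 :: 'p set \<Rightarrow> ('n, 'k) mpoly) \<in> chains dual 0" "0 = p 0"
        by (simp_all add: chains_def elements_def p_def)
      then show "0 \<in> p ` chains dual 0"
        using image_eqI[of 0 p 0 "chains dual 0"] by simp
    next
      fix x y assume "x \<in> p ` chains dual 0" "y \<in> p ` chains dual 0"
      then obtain c c' where c: "c \<in> chains dual 0" "c' \<in> chains dual 0" "x = p c" "y = p c'" by blast
      have "c b \<noteq> 0 \<or> c' b \<noteq> 0" if "(c + c') b \<noteq> 0" for b
        using that by auto
      then have "c + c' \<in> chains dual 0"
        using c(1,2) unfolding chains_def elements_def by blast
      then show "x + y \<in> p ` chains dual 0" by (rule rev_image_eqI) (simp add: c p_add)
    next
      fix s x assume "x \<in> p ` chains dual 0"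
      then obtain c where c: "c \<in> chains dual 0" "x = p c" by blast
      have "c b \<noteq> 0" if "s * c b \<noteq> 0" for b
        using that by auto
      then have "(\<lambda>b. s * c b) \<in> chains dual 0"
        using c(1) unfolding chains_def elements_def by blast
      then show "s * x \<in> p ` chains dual 0" by (rule rev_image_eqI) (simp add: c p_scale)
    qed
    show "xpow ` {dual_exponent a b | b. m_pow b \<in> Irr I} \<subseteq> p ` chains dual 0"
    proof
      fix q assume q: "q \<in> (xpow ` {dual_exponent a b | b. m_pow b \<in> Irr I} :: ('n, 'k) mpoly set)"
      then obtain e where e: "q = xpow e" by (elim imageE)
      have e_dual: "xpow e \<in> alexander_dual a I"
        using module.span_base[OF module_mpoly q] by (simp only: alexander_dual_span e)
      let ?d = "\<lambda>i. int (e i)"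
      have "restr (above (corner ?d)) z \<noteq> 0"
        using e_dual z_zero[OF corner_ge_1] corner_exponents_iff by blast
      then obtain F where F: "F \<in> above (corner ?d)" "z F \<noteq> 0"
        by (auto simp: restr_def fun_eq_iff split: if_splits)
      define v where "v = (\<lambda>G. if G = F then inverse (z F) else 0)"
      have v: "supported (strand dual ?d) v"
        using F(1) by (auto simp: supported_def v_def strand_dual)
      have "from_component dual ?d v \<in> graded_chains dual 0 ?d"
        using z_supp[OF F(2)]
        by (intro dual.from_component_in_chains[OF v]) (auto simp: v_def dual_simps split: if_splits)
      moreover have "p (from_component dual ?d v) = xpow e"
      proof (rule poly_mapping_eqI)
        fix e'
        have sum_1: "(\<Sum>G\<in>above (corner ?d). v G * z G) = 1"
        proof -
          have "(\<Sum>G\<in>above (corner ?d). v G * z G) = (\<Sum>G\<in>above (corner ?d). if G = F then 1 else 0)"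
            by (rule sum.cong) (use F(2) in \<open>auto simp: v_def\<close>)
          then show ?thesis
            using F(1) dual.finite_strand[of ?d] by (simp add: strand_dual)
        qed
        show "Poly_Mapping.lookup (p (from_component dual ?d v)) e' = Poly_Mapping.lookup (xpow e) e'"
        proof (cases "e' = e")
          case True
          then show ?thesis
            unfolding lookup_p pair_def component_from_component[OF v] by (simp add: sum_1)
        next
          case False
          then have "(\<lambda>i. int (e' i)) \<noteq> ?d" by (auto simp: fun_eq_iff)
          then show ?thesis
            unfolding lookup_p pair_def component_from_component[OF v]
            using False by (simp add: lookup_single_not_eq)
        qed
      qed
      ultimately show "q \<in> p ` chains dual 0"
        using image_eqI[of q p "from_component dual ?d v" "chains dual 0"]
        by (simp add: e graded_chains_def)
    qed
  qed
  ultimately have image: "p ` chains dual 0 = alexander_dual a I" by (rule subset_antisym)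
  show ?thesis
    unfolding free_resolution_def
    using dual.is_complex hdeg_nonneg exact p_add p_scale p_homogeneous image kernel
    by (intro conjI exI[of _ p]) auto
qed

text \<open>
  Minimality concerns the entries of the differential, and those of the dual complex are among those of
  \<open>C\<close>.
\<close>

lemma minimal_dual:
  assumes "minimal_complex C"
  shows "minimal_complex dual"
  unfolding minimal_complex_def
proof (intro ballI allI)
  fix c G assume "c \<in> elements dual"
  have dcoeff: "dcoeff C F G \<in> m_pow 1" if FG: "F \<in> basis C" "G \<in> basis C" for F G
  proof -
    \<comment> \<open>The entries are the coefficients of the boundaries of the basis elements.\<close>
    have "(\<lambda>H. if H = F then 1 else 0) \<in> elements C"
      using FG by (auto simp: elements_def)
    then have "bd C (\<lambda>H. if H = F then 1 else 0) G \<in> m_pow 1"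
      using assms unfolding minimal_complex_def by blast
    moreover have "(\<Sum>H\<in>basis C. (if H = F then 1 else 0) * dcoeff C H G) =
        (\<Sum>H\<in>basis C. if H = F then dcoeff C F G else 0)"
      by (rule sum.cong) auto
    ultimately show ?thesis
      using FG finite_basis by (simp add: bd_def)
  qed
  have "(\<Sum>F\<in>basis dual. c F * dcoeff dual F G) \<in> m_pow 1" if "G \<in> basis dual"
    unfolding m_pow_def
  proof (intro module.span_sum[OF module_mpoly] module.span_scale[OF module_mpoly])
    fix F assume "F \<in> basis dual"
    then show "dcoeff dual F G \<in> ideal_span {xpow (0(i := 1 i)) | i. 1 \<le> (1 :: 'n \<Rightarrow> nat) i}"
      using dcoeff[of G F] that by (simp add: dual_simps cellular_complex_def m_pow_def)
  qed
  moreover have "0 \<in> (m_pow 1 :: ('n, 'k) mpoly set)"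
    unfolding m_pow_def by (rule module.span_zero[OF module_mpoly])
  ultimately show "bd dual c G \<in> m_pow 1" by (simp add: bd_def)
qed

end

theorem theorem5p8:
  fixes I :: "('n::finite, 'k::field) mpoly set"
    and a :: "'n \<Rightarrow> nat"
    and X :: "('p, 'n, 'k) cell_complex"
  assumes "CARD('n) \<ge> 2"
    and "monomial_ideal I" and "I \<noteq> UNIV"
    and "lcm_exponent I \<le> a"
    and "labelled_regular_cell_complex X"
    and "cellular_resolution X (ideal_sum I (m_pow (a + 1)))"
    and "complex_length (cellular_complex X) = int CARD('n) - 1"
  shows "let D = shift_complex (- (\<lambda>i. int (a i)) - 1) (1 - int CARD('n))
                  (relative_cocellular_complex X (neg_unbounded X))
         in free_resolution D (alexander_dual a I) \<and>
            (minimal_complex (cellular_complex X) \<longrightarrow> minimal_complex D)"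
proof -
  interpret artinian_closure_resolution I a X
    by unfold_locales (rule assms)+
  show ?thesis
    using free_resolution_dual minimal_dual by (simp add: dual_def)
qed

end
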